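(* Let $P=x^n+a_1x^{n-1}+\cdots+a_n$ be the general monic polynomial of degree $n$ in $x$ with coefficient vector $a=(a_1,\ldots,a_n)\in\mathbb{C}^n$, and let $D\subset\mathbb{C}^n$ be its discriminant set, i.e. the set of $a$ for which $P$ has a multiple root. (1) Suppose that at a point $A\in D$ the corresponding polynomial $P$ has a double root $\lambda\in\mathbb{C}$ and $n-2$ simple roots. Then: (i) if in addition $\lambda\neq 0$ (hence one does not have $a_{n-1}=a_n=0$ at $A$), then for every $k=1,\ldots,n$ the set $D$ is, at the point $A$, locally the graph of an analytic function in the variables $a^k=(a_1,\ldots,a_{k-1},a_{k+1},\ldots,a_n)$; (ii) if $\lambda=0$, then this property (that at $A$ the set $D$ is locally the graph of an analytic function in $a^k$) holds true for $k=n$ and fails for each $k=1,\ldots,n-1$. (2) Suppose that at a point $A\in D$ the corresponding polynomial $P$ has a root of multiplicity at least $3$. Then at $A$ the hypersurface $D$ is not smooth.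
   Context: The discriminant set is $D:=\{a\in\mathbb{C}^n \mid \mathrm{Res}(P,P',x)=0\}$, where $P'$ is the derivative of $P$ with respect to $x$; it is the set of values of $a$ for which $P$ has a multiple root. For $1\le k\le n$, $a^k:=(a_1,\ldots,a_{k-1},a_{k+1},\ldots,a_n)\in\mathbb{C}^{n-1}$ denotes the tuple of all coefficients except $a_k$. "At $A$ the set $D$ is locally the graph of an analytic function in $a^k$" means: writing $A=(A_1,\ldots,A_n)$, there are open neighbourhoods $W\subset\mathbb{C}^{n-1}$ of $A^k$ and $V\subset\mathbb{C}$ of $A_k$ and a holomorphic function $f:W\to V$ such that, for $a^k\in W$ and $a_k\in V$, one has $a\in D$ if and only if $a_k=f(a^k)$. "$D$ is smooth at $A$" means that $D$ is a complex-analytic submanifold of $\mathbb{C}^n$ of dimension $n-1$ in some neighbourhood of $A$. *)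

theory Defs
  imports "HOL-Analysis.Analysis" "HOL-Computational_Algebra.Field_as_Ring"
    "HOL-Computational_Algebra.Fundamental_Theorem_Algebra"
    "Subresultants.Subresultant_Gcd"
begin

text \<open>
  A point of $\mathbf{C}^I$, for a finite set $I$ of indices, is a function that is extensional
  on $I$; $\mathbf{C}^n$ is $\mathbf{C}^I$ for $I = \{1,\dots,n\}$. Forgetting the $k$-th
  coordinate is restriction to $I - \{k\}$.
\<close>

abbreviation ctop :: "nat set \<Rightarrow> (nat \<Rightarrow> complex) topology" where
  "ctop I \<equiv> product_topology (\<lambda>_. euclidean) I"

abbreviation cspace :: "nat set \<Rightarrow> (nat \<Rightarrow> complex) set" where
  "cspace I \<equiv> (\<Pi>\<^sub>E i\<in>I. UNIV)"

definition cdist :: "nat set \<Rightarrow> (nat \<Rightarrow> complex) \<Rightarrow> (nat \<Rightarrow> complex) \<Rightarrow> real" where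
  "cdist I z w = L2_set (\<lambda>i. cmod (z i - w i)) I"

text \<open>
  Holomorphic functions of several variables: at every point of the open set \<open>W\<close> there is a
  complex-linear differential \<open>\<lambda>v. \<Sum>i\<in>I. c i * v i\<close>.
\<close>

definition holomorphic_in :: "nat set \<Rightarrow> ((nat \<Rightarrow> complex) \<Rightarrow> complex) \<Rightarrow> (nat \<Rightarrow> complex) set \<Rightarrow> bool" where
  "holomorphic_in I f W \<longleftrightarrow> openin (ctop I) W \<and>
     (\<forall>w\<in>W. \<exists>c :: nat \<Rightarrow> complex. \<forall>e>0. \<exists>d>0. \<forall>z\<in>W. cdist I z w < d \<longrightarrow>
        cmod (f z - f w - (\<Sum>i\<in>I. c i * (z i - w i))) \<le> e * cdist I z w)"

definition biholomorphic :: "nat set \<Rightarrow> ((nat \<Rightarrow> complex) \<Rightarrow> nat \<Rightarrow> complex) \<Rightarrow>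
    (nat \<Rightarrow> complex) set \<Rightarrow> (nat \<Rightarrow> complex) set \<Rightarrow> bool" where
  "biholomorphic I \<phi> U V \<longleftrightarrow> bij_betw \<phi> U V \<and>
     (\<forall>i\<in>I. holomorphic_in I (\<lambda>z. \<phi> z i) U) \<and>
     (\<forall>i\<in>I. holomorphic_in I (\<lambda>z. inv_into U \<phi> z i) V) \<and>
     openin (ctop I) U \<and> openin (ctop I) V"

text \<open>
  A \<open>d\<close>-dimensional complex-analytic submanifold of $\mathbf{C}^n$: near each of its points it is
  straightened to $\{z \mid z_{d+1} = \dots = z_n = 0\}$ by holomorphic coordinates of the
  ambient space.
\<close>

definition complex_submanifold :: "nat \<Rightarrow> nat \<Rightarrow> (nat \<Rightarrow> complex) set \<Rightarrow> bool" where
  "complex_submanifold n d S \<longleftrightarrow> d \<le> n \<and> S \<subseteq> cspace {1..n} \<and>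
     (\<forall>p\<in>S. \<exists>U V \<phi>. p \<in> U \<and> biholomorphic {1..n} \<phi> U V \<and>
        \<phi> ` (S \<inter> U) = {z\<in>V. \<forall>i\<in>{d<..n}. z i = 0})"

definition smooth_hypersurface_at :: "nat \<Rightarrow> (nat \<Rightarrow> complex) set \<Rightarrow> (nat \<Rightarrow> complex) \<Rightarrow> bool" where
  "smooth_hypersurface_at n S A \<longleftrightarrow>
     (\<exists>N. openin (ctop {1..n}) N \<and> A \<in> N \<and> complex_submanifold n (n - 1) (S \<inter> N))"

definition omit :: "nat \<Rightarrow> nat \<Rightarrow> (nat \<Rightarrow> complex) \<Rightarrow> (nat \<Rightarrow> complex)" where
  "omit n k a = restrict a ({1..n} - {k})"

definition locally_graph_at :: "nat \<Rightarrow> nat \<Rightarrow> (nat \<Rightarrow> complex) set \<Rightarrow> (nat \<Rightarrow> complex) \<Rightarrow> bool" where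
  "locally_graph_at n k S A \<longleftrightarrow>
     (\<exists>W V f. openin (ctop ({1..n} - {k})) W \<and> omit n k A \<in> W \<and> open V \<and> A k \<in> V \<and>
        holomorphic_in ({1..n} - {k}) f W \<and> f ` W \<subseteq> V \<and>
        (\<forall>a\<in>cspace {1..n}. omit n k a \<in> W \<and> a k \<in> V \<longrightarrow> (a \<in> S \<longleftrightarrow> a k = f (omit n k a))))"

definition gen_poly :: "nat \<Rightarrow> (nat \<Rightarrow> complex) \<Rightarrow> complex poly" where
  "gen_poly n a = monom 1 n + (\<Sum>i=1..n. monom (a i) (n - i))"

definition discriminant_set :: "nat \<Rightarrow> (nat \<Rightarrow> complex) set" where
  "discriminant_set n =
     {a\<in>cspace {1..n}. resultant (gen_poly n a) (pderiv (gen_poly n a)) = 0}"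

lemma coeff_gen_poly_top: "coeff (gen_poly n a) n = 1"
  by (auto simp: gen_poly_def coeff_sum intro!: sum.neutral)

lemma gen_poly_nonzero [simp]: "gen_poly n a \<noteq> 0"
  using coeff_gen_poly_top[of n a] by auto

lemma discriminant_set_iff_multiple_root:
  "a \<in> discriminant_set n \<longleftrightarrow> a \<in> cspace {1..n} \<and> (\<exists>x. 2 \<le> order x (gen_poly n a))"
proof -
  let ?p = "gen_poly n a"
  have "degree (gcd ?p (pderiv ?p)) \<noteq> 0 \<longleftrightarrow> (\<exists>x. poly (gcd ?p (pderiv ?p)) x = 0)"
  proof
    assume "degree (gcd ?p (pderiv ?p)) \<noteq> 0"
    then show "\<exists>x. poly (gcd ?p (pderiv ?p)) x = 0"
      by (intro fundamental_theorem_of_algebra) (simp add: constant_degree)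
  next
    assume "\<exists>x. poly (gcd ?p (pderiv ?p)) x = 0"
    then obtain x where x: "poly (gcd ?p (pderiv ?p)) x = 0" by blast
    show "degree (gcd ?p (pderiv ?p)) \<noteq> 0"
    proof
      assume "degree (gcd ?p (pderiv ?p)) = 0"
      then obtain c where c: "gcd ?p (pderiv ?p) = [:c:]" by (rule degree_eq_zeroE)
      with x have "gcd ?p (pderiv ?p) = 0" by simp
      then show False by simp
    qed
  qed
  also have "\<dots> \<longleftrightarrow> (\<exists>x. poly ?p x = 0 \<and> poly (pderiv ?p) x = 0)"
    by (simp add: poly_eq_0_iff_dvd)
  also have "\<dots> \<longleftrightarrow> (\<exists>x. 2 \<le> order x ?p)"
  proof (intro arg_cong[where f = Ex] ext)
    fix x
    show "(poly ?p x = 0 \<and> poly (pderiv ?p) x = 0) = (2 \<le> order x ?p)"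
    proof (cases "poly ?p x = 0")
      case True
      show ?thesis
      proof (cases "pderiv ?p = 0")
        case True
        then have "degree ?p = 0" by (simp add: pderiv_eq_0_iff)
        then obtain c where "?p = [:c:]" by (rule degree_eq_zeroE)
        with \<open>poly ?p x = 0\<close> have "?p = 0" by simp
        then show ?thesis by simp
      next
        case False
        then have "order x ?p = Suc (order x (pderiv ?p))"
          using \<open>poly ?p x = 0\<close> by (intro order_pderiv) simp_all
        then show ?thesis using False \<open>poly ?p x = 0\<close> by (auto simp: order_root)
      qed
    qed (auto simp: order_root)
  qed
  finally show ?thesis by (simp add: discriminant_set_def resultant_0_gcd)
qed

end

theory Submission
  imports Defs "HOL-Complex_Analysis.Cauchy_Integral_Formula"
begin

text \<open>
  Write $P_a$ for the polynomial with coefficient vector $a$. Double roots. If $\lambda \neq 0$ or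
  $k = n$, the condition on $x$ to be a double root of $P_a$ for a suitable value of $a_k$ is a
  polynomial equation that does not involve $a_k$ and has $\lambda$ as a simple root at $A$; so $x$
  is a locally Lipschitz function of $a^k$, and $a_k = f(a^k)$ is read off from $P_a(x) = 0$. Since
  $P_a$ vanishes to second order at $x$, the Lipschitz property of $x$ suffices for $f$ to be
  differentiable, with $\partial f / \partial a_i = - x^{n-i} / x^{n-k}$.

  Triple roots. After a small perturbation the multiplicity is exactly three, $P_A = y^3 Q$ with
  $y = x - \lambda$ and $Q(\lambda) \neq 0$. A holomorphic function $h$ that vanishes on the
  discriminant set near $A$ has zero gradient at $A$: the gradient annihilates $y^2 S$, $y Q$ and $Q$,
  which together span all polynomials of degree less than $n$. The last coordinate of a chart has a
  nonzero gradient.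
\<close>

subsection \<open>Gradients of functions of several complex variables\<close>

text \<open>The derivative formula says that the tangent hyperplane of the discriminant set at a
  double root \<open>x\<close> is \<open>sum_i x^(n-i) da_i = 0\<close>. It can be solved for
  \<open>da_k\<close> exactly when \<open>x^(n-k)\<close> is nonzero; at \<open>x = 0\<close> it is
  \<open>da_n = 0\<close>, and only \<open>k = n\<close> remains. At a triple root the obstacle is
  the direction \<open>Q\<close>. In the plane of \<open>y Q\<close> and \<open>Q\<close> the
  discriminant set contains the cusp \<open>(-3 s^2, 2 s^3)\<close>, whose tangent is
  \<open>y Q\<close>, so first-order arguments at the base point do not reach \<open>Q\<close>.
  Second-order information on \<open>h\<close> is required, although holomorphy only provides a
  gradient at each point. It comes from restricting \<open>h\<close> to complex lines parallel to
  \<open>Q\<close>, where one-variable Cauchy estimates hold uniformly: each such line near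
  \<open>A\<close> meets both branches of the cusp. A zero gradient contradicts the existence of a
  chart because the inverse chart is differentiable too: the preimage of a line in the last
  coordinate direction is a curve on which the last coordinate grows at rate 1.\<close>

lemma openin_ctop_contains_box:
  assumes "finite I" "openin (ctop I) W" "w \<in> W"
  obtains e where "0 < e" "\<And>z. z \<in> cspace I \<Longrightarrow> (\<And>i. i \<in> I \<Longrightarrow> cmod (z i - w i) < e) \<Longrightarrow> z \<in> W"
proof -
  obtain U where U: "\<And>i. i \<in> I \<Longrightarrow> open (U i)" "w \<in> Pi\<^sub>E I U" "Pi\<^sub>E I U \<subseteq> W"
    using assms(2,3) unfolding openin_product_topology_alt by (metis open_openin)
  have "\<forall>i\<in>I. \<exists>e>0. ball (w i) e \<subseteq> U i"
    using U by (metis PiE_mem open_contains_ball)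
  then obtain e where e: "\<And>i. i \<in> I \<Longrightarrow> 0 < e i \<and> ball (w i) (e i) \<subseteq> U i" by metis
  show thesis
  proof
    show "0 < Min (insert 1 (e ` I))" using assms(1) e by auto
    fix z assume z: "z \<in> cspace I" "\<And>i. i \<in> I \<Longrightarrow> cmod (z i - w i) < Min (insert 1 (e ` I))"
    have "z i \<in> U i" if "i \<in> I" for i
    proof -
      have "Min (insert 1 (e ` I)) \<le> e i" using assms(1) that by auto
      with z(2)[OF that] have "z i \<in> ball (w i) (e i)" by (simp add: dist_norm norm_minus_commute)
      with e that show ?thesis by blast
    qed
    with z(1) have "z \<in> Pi\<^sub>E I U" by (auto simp: PiE_iff)
    with U show "z \<in> W" by blast
  qed
qed

lemma openin_ctop_box:
  assumes "finite I"
  shows "openin (ctop I) {z \<in> cspace I. \<forall>i\<in>I. cmod (z i - w i) < e}"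
proof -
  have "{z \<in> cspace I. \<forall>i\<in>I. cmod (z i - w i) < e} = (\<Pi>\<^sub>E i\<in>I. ball (w i) e)"
    by (auto simp: PiE_iff extensional_def dist_norm norm_minus_commute)
  then show ?thesis using assms by (simp add: openin_PiE flip: open_openin)
qed

lemma openin_ctop_subset: "openin (ctop I) W \<Longrightarrow> W \<subseteq> cspace I"
  using openin_subset by fastforce

lemma norm_le_cdist:
  assumes "finite I" "i \<in> I"
  shows "cmod (z i - w i) \<le> cdist I z w"
  unfolding cdist_def using assms by (intro member_le_L2_set[where f = "\<lambda>i. cmod (z i - w i)"]) auto

lemma cdist_le_sum: "cdist I z w \<le> (\<Sum>i\<in>I. cmod (z i - w i))"
  unfolding cdist_def by (rule L2_set_le_sum) auto

lemma cdist_nonneg [simp]: "0 \<le> cdist I z w"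
  by (simp add: cdist_def L2_set_nonneg)

text \<open>The differential clause of \<open>holomorphic_in\<close> at one point, with the
  coefficients as a parameter, so that they can be computed for a graph and shown to vanish for a
  chart.\<close>

definition has_gradient ::
  "nat set \<Rightarrow> ((nat \<Rightarrow> complex) \<Rightarrow> complex) \<Rightarrow> (nat \<Rightarrow> complex) set \<Rightarrow> (nat \<Rightarrow> complex) \<Rightarrow> (nat \<Rightarrow> complex) \<Rightarrow> bool" where
  "has_gradient I f W w c \<longleftrightarrow> (\<forall>e>0. \<exists>d>0. \<forall>z\<in>W. cdist I z w < d \<longrightarrow>
        cmod (f z - f w - (\<Sum>i\<in>I. c i * (z i - w i))) \<le> e * cdist I z w)"

lemma holomorphic_in_iff_gradient:
  "holomorphic_in I f W \<longleftrightarrow> openin (ctop I) W \<and> (\<forall>w\<in>W. \<exists>c. has_gradient I f W w c)"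
  by (simp add: holomorphic_in_def has_gradient_def)

lemma has_gradient_subset:
  assumes "has_gradient I f W w c" "W' \<subseteq> W"
  shows "has_gradient I f W' w c"
  unfolding has_gradient_def
proof (intro allI impI)
  fix e :: real assume "0 < e"
  then obtain d where "0 < d" "\<And>z. z \<in> W \<Longrightarrow> cdist I z w < d \<Longrightarrow>
      cmod (f z - f w - (\<Sum>i\<in>I. c i * (z i - w i))) \<le> e * cdist I z w"
    using assms(1) unfolding has_gradient_def by meson
  with assms(2) show "\<exists>d>0. \<forall>z\<in>W'. cdist I z w < d \<longrightarrow>
      cmod (f z - f w - (\<Sum>i\<in>I. c i * (z i - w i))) \<le> e * cdist I z w"
    by (intro exI[of _ d]) auto
qed

lemma has_gradient_continuous:
  assumes "has_gradient I f W w c" "finite I" "0 < e"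
  obtains d where "0 < d" "\<And>z. z \<in> W \<Longrightarrow> (\<And>i. i \<in> I \<Longrightarrow> cmod (z i - w i) < d) \<Longrightarrow> cmod (f z - f w) < e"
proof -
  have "\<exists>d>0. \<forall>z\<in>W. cdist I z w < d \<longrightarrow>
      cmod (f z - f w - (\<Sum>i\<in>I. c i * (z i - w i))) \<le> 1 * cdist I z w"
    using assms(1) unfolding has_gradient_def by (rule allE[of _ "1 :: real"]) simp
  then obtain d where d: "0 < d" "\<And>z. z \<in> W \<Longrightarrow> cdist I z w < d \<Longrightarrow>
      cmod (f z - f w - (\<Sum>i\<in>I. c i * (z i - w i))) \<le> 1 * cdist I z w"
    by metis
  define K where "K = 1 + (\<Sum>i\<in>I. cmod (c i))"
  have K: "0 < K" unfolding K_def by (intro add_pos_nonneg sum_nonneg) auto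
  define N where "N = 1 + real (card I)"
  have N: "0 < N" by (simp add: N_def)
  define d' where "d' = min d (e / K) / N"
  have d': "0 < d'" using d K N assms(3) by (simp add: d'_def)
  show thesis
  proof
    show "0 < d'" by fact
    fix z assume z: "z \<in> W" "\<And>i. i \<in> I \<Longrightarrow> cmod (z i - w i) < d'"
    have "cdist I z w \<le> (\<Sum>i\<in>I. cmod (z i - w i))" by (rule cdist_le_sum)
    also have "\<dots> \<le> (\<Sum>i\<in>I. d')" using z(2) by (intro sum_mono) (simp add: less_imp_le)
    also have "\<dots> < N * d'" using d' by (simp add: N_def algebra_simps)
    also have "\<dots> = min d (e / K)" using N by (simp add: d'_def)
    finally have D: "cdist I z w < d" "cdist I z w < e / K" by auto
    have "cmod (\<Sum>i\<in>I. c i * (z i - w i)) \<le> (\<Sum>i\<in>I. cmod (c i) * cdist I z w)"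
      using norm_le_cdist[OF assms(2)] by (intro sum_norm_le) (auto simp: norm_mult intro!: mult_left_mono)
    moreover have "cmod (f z - f w) \<le> cmod (f z - f w - (\<Sum>i\<in>I. c i * (z i - w i)))
        + cmod (\<Sum>i\<in>I. c i * (z i - w i))" by (metis diff_add_cancel norm_triangle_ineq)
    ultimately have "cmod (f z - f w) \<le> K * cdist I z w"
      using d(2)[OF z(1) D(1)] by (simp add: K_def algebra_simps sum_distrib_left)
    also have "\<dots> < e" using D(2) K by (simp add: field_simps)
    finally show "cmod (f z - f w) < e" .
  qed
qed

lemma has_gradient_tendsto:
  assumes "has_gradient I f W w c" "finite I" "\<forall>\<^sub>F t in F. \<gamma> t \<in> W"
    "\<And>i. i \<in> I \<Longrightarrow> ((\<lambda>t. \<gamma> t i) \<longlongrightarrow> w i) F"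
  shows "((\<lambda>t. f (\<gamma> t)) \<longlongrightarrow> f w) F"
proof (rule tendstoI)
  fix e :: real assume "0 < e"
  then obtain d where d: "0 < d"
    "\<And>z. z \<in> W \<Longrightarrow> (\<And>i. i \<in> I \<Longrightarrow> cmod (z i - w i) < d) \<Longrightarrow> cmod (f z - f w) < e"
    using has_gradient_continuous[OF assms(1,2)] by metis
  have "\<forall>\<^sub>F t in F. \<forall>i\<in>I. cmod (\<gamma> t i - w i) < d"
    using assms(2,4) d(1) by (intro eventually_ball_finite) (auto simp: tendsto_iff dist_norm)
  with assms(3) show "\<forall>\<^sub>F t in F. dist (f (\<gamma> t)) (f w) < e"
    by eventually_elim (auto simp: dist_norm intro: d(2))
qed

text \<open>A chain rule in which only the difference quotients at the base point, in the scale
  \<open>\<sigma>\<close>, must converge. It serves sequences, complex derivatives along a line, and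
  curves whose velocity appears in a scale such as \<open>s^2\<close>.\<close>

lemma has_gradient_along:
  assumes "has_gradient I f W w c" "finite I" "\<forall>\<^sub>F t in F. \<gamma> t \<in> W"
    "(\<sigma> \<longlongrightarrow> 0) F" "\<forall>\<^sub>F t in F. \<sigma> t \<noteq> 0"
    "\<And>i. i \<in> I \<Longrightarrow> ((\<lambda>t. (\<gamma> t i - w i) / \<sigma> t) \<longlongrightarrow> v i) F"
  shows "((\<lambda>t. (f (\<gamma> t) - f w) / \<sigma> t) \<longlongrightarrow> (\<Sum>i\<in>I. c i * v i)) F"
proof -
  define K where "K = 1 + (\<Sum>i\<in>I. cmod (v i))"
  have K: "0 < K" unfolding K_def by (intro add_pos_nonneg sum_nonneg) auto
  have "((\<lambda>t. \<Sum>i\<in>I. cmod ((\<gamma> t i - w i) / \<sigma> t)) \<longlongrightarrow> (\<Sum>i\<in>I. cmod (v i))) F"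
    by (intro tendsto_intros assms(6))
  then have "\<forall>\<^sub>F t in F. (\<Sum>i\<in>I. cmod ((\<gamma> t i - w i) / \<sigma> t)) < K"
    by (rule order_tendstoD) (simp add: K_def)
  then have dist: "\<forall>\<^sub>F t in F. cdist I (\<gamma> t) w \<le> K * cmod (\<sigma> t)"
    using assms(5)
  proof eventually_elim
    case (elim t)
    have "cdist I (\<gamma> t) w \<le> (\<Sum>i\<in>I. cmod (\<gamma> t i - w i))" by (rule cdist_le_sum)
    also have "\<dots> = (\<Sum>i\<in>I. cmod ((\<gamma> t i - w i) / \<sigma> t)) * cmod (\<sigma> t)"
      using elim by (simp add: sum_distrib_right norm_divide)
    also have "\<dots> \<le> K * cmod (\<sigma> t)" using elim by (intro mult_right_mono) auto
    finally show ?case .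
  qed
  have "((\<lambda>t. (f (\<gamma> t) - f w - (\<Sum>i\<in>I. c i * (\<gamma> t i - w i))) / \<sigma> t) \<longlongrightarrow> 0) F"
  proof (rule tendstoI)
    fix e :: real assume e: "0 < e"
    obtain d where d: "0 < d" "\<And>z. z \<in> W \<Longrightarrow> cdist I z w < d \<Longrightarrow>
      cmod (f z - f w - (\<Sum>i\<in>I. c i * (z i - w i))) \<le> e / (2 * K) * cdist I z w"
      using assms(1) e K unfolding has_gradient_def
      by (metis divide_pos_pos mult_pos_pos zero_less_numeral)
    have "\<forall>\<^sub>F t in F. cmod (\<sigma> t) < d / K"
      using assms(4) d K by (auto simp: tendsto_iff)
    with dist assms(3,5) show "\<forall>\<^sub>F t in F.
        dist ((f (\<gamma> t) - f w - (\<Sum>i\<in>I. c i * (\<gamma> t i - w i))) / \<sigma> t) 0 < e"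
    proof eventually_elim
      case (elim t)
      have "K * cmod (\<sigma> t) < d" using elim K by (simp add: field_simps)
      with elim have "cdist I (\<gamma> t) w < d" by simp
      from d(2)[OF elim(2) this]
      have "cmod (f (\<gamma> t) - f w - (\<Sum>i\<in>I. c i * (\<gamma> t i - w i))) \<le> e / (2 * K) * (K * cmod (\<sigma> t))"
        using elim(1) e K by (smt (verit) divide_nonneg_pos mult_left_mono)
      then have "cmod (f (\<gamma> t) - f w - (\<Sum>i\<in>I. c i * (\<gamma> t i - w i))) \<le> e / 2 * cmod (\<sigma> t)"
        using K by simp
      also have "\<dots> < e * cmod (\<sigma> t)" using elim e by simp
      finally show ?case using elim by (simp add: norm_divide field_simps)
    qed
  qed
  moreover have "((\<lambda>t. \<Sum>i\<in>I. c i * ((\<gamma> t i - w i) / \<sigma> t)) \<longlongrightarrow> (\<Sum>i\<in>I. c i * v i)) F"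
    by (intro tendsto_intros assms(6))
  ultimately have "((\<lambda>t. (f (\<gamma> t) - f w - (\<Sum>i\<in>I. c i * (\<gamma> t i - w i))) / \<sigma> t
      + (\<Sum>i\<in>I. c i * ((\<gamma> t i - w i) / \<sigma> t))) \<longlongrightarrow> 0 + (\<Sum>i\<in>I. c i * v i)) F"
    by (rule tendsto_add)
  moreover have "(f (\<gamma> t) - f w - (\<Sum>i\<in>I. c i * (\<gamma> t i - w i))) / \<sigma> t
      + (\<Sum>i\<in>I. c i * ((\<gamma> t i - w i) / \<sigma> t)) = (f (\<gamma> t) - f w) / \<sigma> t" for t
    by (simp add: diff_divide_distrib sum_divide_distrib right_diff_distrib)
  ultimately show ?thesis by simp
qed

subsection \<open>Perturbation of polynomials and their roots\<close>

lemma order_ge_2_iff: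
  fixes p :: "complex poly"
  assumes "p \<noteq> 0"
  shows "2 \<le> order x p \<longleftrightarrow> poly p x = 0 \<and> poly (pderiv p) x = 0"
proof (cases "poly p x = 0")
  case True
  show ?thesis
  proof (cases "pderiv p = 0")
    case True
    then have "degree p = 0" by (simp add: pderiv_eq_0_iff)
    then obtain c where "p = [:c:]" by (rule degree_eq_zeroE)
    with \<open>poly p x = 0\<close> assms show ?thesis by simp
  next
    case False
    then have "order x p = Suc (order x (pderiv p))"
      using \<open>poly p x = 0\<close> assms by (intro order_pderiv) simp_all
    then show ?thesis using False \<open>poly p x = 0\<close> by (auto simp: order_root)
  qed
qed (auto simp: order_root)

text \<open>Counting with multiplicity, a second multiple root would bring the total to at least
  \<open>2 + 2 + (degree p - 2)\<close>, more than the degree. The root \<open>l\<close> ensures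
  \<open>2 \<le> degree p\<close>, so the truncated subtraction is exact.\<close>

lemma unique_multiple_root:
  fixes p :: "complex poly"
  assumes "p \<noteq> 0" "order l p = 2" "card {x. order x p = 1} = degree p - 2" "2 \<le> order x p"
  shows "x = l"
proof (rule ccontr)
  assume "x \<noteq> l"
  let ?S = "{x. order x p = 1}" and ?R = "{x. poly p x = 0}"
  have "finite ?R" using assms(1) by (rule poly_roots_finite)
  moreover have sub: "insert x (insert l ?S) \<subseteq> ?R"
    using assms by (auto simp: order_root)
  ultimately have fin: "finite ?S" by (auto intro: finite_subset)
  have "(\<Sum>y\<in>insert x (insert l ?S). order y p) \<le> (\<Sum>y\<in>?R. order y p)"
    using \<open>finite ?R\<close> sub by (intro sum_mono2) auto
  also have "\<dots> = size (proots p)"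
    using assms(1) by (simp add: size_multiset_overloaded_eq)
  also have "\<dots> \<le> degree p" by (rule size_proots_le)
  also have "(\<Sum>y\<in>insert x (insert l ?S). order y p) = order x p + (order l p + card ?S)"
    using fin \<open>x \<noteq> l\<close> assms(2,4) by simp
  finally show False
    using assms order_degree[OF assms(1), of l] by linarith
qed

lemma poly_eq_sum:
  fixes p :: "'a::comm_semiring_1 poly"
  assumes "degree p \<le> N"
  shows "poly p x = (\<Sum>j\<le>N. coeff p j * x ^ j)"
  unfolding poly_altdef using assms
  by (intro sum.mono_neutral_left) (auto simp: coeff_eq_0)

lemma poly_perturbation:
  fixes p q :: "complex poly"
  assumes "degree p \<le> N" "degree q \<le> N" "\<And>j. j \<le> N \<Longrightarrow> cmod (coeff p j - coeff q j) \<le> e" "cmod x \<le> M"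
  shows "cmod (poly p x - poly q x) \<le> e * (\<Sum>j\<le>N. M ^ j)"
proof -
  have "poly p x - poly q x = (\<Sum>j\<le>N. (coeff p j - coeff q j) * x ^ j)"
    using assms(1,2) by (simp add: poly_eq_sum[of _ N] sum_subtractf left_diff_distrib)
  also have "cmod \<dots> \<le> (\<Sum>j\<le>N. e * M ^ j)"
  proof (rule sum_norm_le)
    fix j assume j: "j \<in> {..N}"
    have "0 \<le> e" using assms(3)[of j] j by (meson atMost_iff norm_ge_zero order_trans)
    then show "cmod ((coeff p j - coeff q j) * x ^ j) \<le> e * M ^ j"
      unfolding norm_mult norm_power
      using assms(3)[of j] j assms(4) by (intro mult_mono power_mono) auto
  qed
  finally show ?thesis by (simp add: sum_distrib_left)
qed

lemma pderiv_perturbation: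
  fixes p q :: "complex poly"
  assumes "degree p \<le> N" "degree q \<le> N" "\<And>j. j \<le> N \<Longrightarrow> cmod (coeff p j - coeff q j) \<le> e" "cmod x \<le> M"
  shows "cmod (poly (pderiv p) x - poly (pderiv q) x) \<le> N * e * (\<Sum>j\<le>N. M ^ j)"
proof (rule poly_perturbation)
  show "degree (pderiv p) \<le> N" "degree (pderiv q) \<le> N" using assms by (simp_all add: degree_pderiv)
  fix j assume "j \<le> N"
  have e: "0 \<le> e" using assms(3)[of 0] by (meson le0 norm_ge_zero order_trans)
  show "cmod (coeff (pderiv p) j - coeff (pderiv q) j) \<le> N * e"
  proof (cases "Suc j \<le> N")
    case True
    have "coeff (pderiv p) j - coeff (pderiv q) j = of_nat (Suc j) * (coeff p (Suc j) - coeff q (Suc j))"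
      by (simp add: coeff_pderiv algebra_simps)
    then have "cmod (coeff (pderiv p) j - coeff (pderiv q) j) = Suc j * cmod (coeff p (Suc j) - coeff q (Suc j))"
      by (metis norm_mult norm_of_nat)
    also have "\<dots> \<le> N * e" using True assms(3) e by (intro mult_mono) auto
    finally show ?thesis .
  next
    case False
    then show ?thesis using assms(1,2) e by (simp add: coeff_pderiv coeff_eq_0)
  qed
qed fact

text \<open>Existence of the nearby root: \<open>x \<mapsto> x - H(x)/d\<close>, with \<open>d\<close> the derivative at the unperturbed
  root, is a contraction.\<close>

lemma simple_root_stable:
  fixes H0 :: "complex poly"
  assumes H0: "poly H0 l = 0" "poly (pderiv H0) l \<noteq> 0" "degree H0 \<le> N" and "0 < r0"
  obtains r e c where "0 < r" "r \<le> r0" "0 < e" "0 < c"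
    "\<And>H. degree H \<le> N \<Longrightarrow> (\<And>j. j \<le> N \<Longrightarrow> cmod (coeff H j - coeff H0 j) \<le> e) \<Longrightarrow> \<exists>x\<in>cball l r. poly H x = 0"
    "\<And>H x y. degree H \<le> N \<Longrightarrow> (\<And>j. j \<le> N \<Longrightarrow> cmod (coeff H j - coeff H0 j) \<le> e) \<Longrightarrow>
       x \<in> cball l r \<Longrightarrow> y \<in> cball l r \<Longrightarrow> c * cmod (x - y) \<le> cmod (poly H x - poly H y)"
proof -
  define d where "d = poly (pderiv H0) l"
  have d: "0 < cmod d" using H0 by (simp add: d_def)
  have "isCont (poly (pderiv H0)) l" by simp
  then obtain s where s: "0 < s" "\<And>x. dist x l < s \<Longrightarrow> dist (poly (pderiv H0) x) d < cmod d / 4"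
    unfolding continuous_at_eps_delta d_def using d by (metis d_def divide_pos_pos zero_less_numeral)
  define r where "r = min (s / 2) r0"
  have r: "0 < r" "r \<le> r0" "r < s" using s \<open>0 < r0\<close> by (auto simp: r_def)
  define S where "S = (\<Sum>j\<le>N. (cmod l + r) ^ j)"
  have S: "0 \<le> S" unfolding S_def using r by (intro sum_nonneg) simp
  \<comment> \<open>One factor for both perturbation bounds: \<open>S\<close> for values and
    \<open>N * S\<close> for derivatives.\<close>
  define T where "T = (N + 1) * S + 1"
  have "T = N * S + S + 1" by (simp add: T_def algebra_simps)
  moreover have "0 \<le> N * S" using S by simp
  ultimately have T: "0 < T" "S \<le> T" "N * S \<le> T" using S by linarith+
  \<comment> \<open>The first bound, with the other quarter from the choice of \<open>s\<close>,
    keeps the derivative of \<open>H\<close> within \<open>|d|/2\<close> of \<open>d\<close>; the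
    second keeps the image of the centre within \<open>r/2\<close> of it.\<close>
  define e where "e = min (cmod d / 4) (cmod d * r / 2) / T"
  have e: "0 < e" "T * e \<le> cmod d / 4" "T * e \<le> cmod d * r / 2"
    using d r T by (auto simp: e_def)
  have bnd: "cmod x \<le> cmod l + r" if "x \<in> cball l r" for x
    using that norm_triangle_ineq[of l "x - l"] by (simp add: dist_norm norm_minus_commute)
  \<comment> \<open>Used twice: after division by \<open>d\<close> it gives the contraction factor
    \<open>1/2\<close>, and by the reverse triangle inequality the lower bound with
    \<open>c = |d|/2\<close>, hence uniqueness of the root.\<close>
  have lip: "cmod ((poly H x - d * x) - (poly H y - d * y)) \<le> cmod d / 2 * cmod (x - y)"
    if H: "degree H \<le> N" "\<And>j. j \<le> N \<Longrightarrow> cmod (coeff H j - coeff H0 j) \<le> e"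
      and xy: "x \<in> cball l r" "y \<in> cball l r" for H x y
  proof (rule field_differentiable_bound[where S = "cball l r" and f' = "\<lambda>z. poly (pderiv H) z - d"])
    fix z assume z: "z \<in> cball l r"
    show "((\<lambda>x. poly H x - d * x) has_field_derivative poly (pderiv H) z - d) (at z within cball l r)"
      by (auto intro!: derivative_eq_intros poly_DERIV[THEN has_field_derivative_at_within])
    have "cmod (poly (pderiv H) z - poly (pderiv H0) z) \<le> N * e * S"
      unfolding S_def by (rule pderiv_perturbation) (use H H0 bnd[OF z] in auto)
    also have "\<dots> \<le> T * e" using mult_right_mono[OF T(3), of e] e by (simp add: mult_ac)
    finally have "cmod (poly (pderiv H) z - poly (pderiv H0) z) \<le> cmod d / 4" using e by simp
    moreover have "cmod (poly (pderiv H0) z - d) < cmod d / 4"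
      using s(2)[of z] z r by (simp add: dist_norm norm_minus_commute)
    ultimately show "cmod (poly (pderiv H) z - d) \<le> cmod d / 2"
      using norm_triangle_ineq[of "poly (pderiv H) z - poly (pderiv H0) z" "poly (pderiv H0) z - d"] by simp
  qed (use xy in auto)
  show thesis
  proof (rule that[of r e "cmod d / 2"])
    fix H assume H: "degree H \<le> N" "\<And>j. j \<le> N \<Longrightarrow> cmod (coeff H j - coeff H0 j) \<le> e"
    let ?g = "\<lambda>x. x - poly H x / d"
    have g: "dist (?g x) (?g y) \<le> 1 / 2 * dist x y" if "x \<in> cball l r" "y \<in> cball l r" for x y
    proof -
      have "?g x - ?g y = - ((poly H x - d * x) - (poly H y - d * y)) / d"
        using d by (simp add: field_simps)
      then have "cmod (?g x - ?g y) = cmod ((poly H x - d * x) - (poly H y - d * y)) / cmod d"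
        by (simp only: norm_divide norm_minus_cancel)
      also have "\<dots> \<le> (cmod d / 2 * cmod (x - y)) / cmod d"
        using lip[OF H that] d by (intro divide_right_mono) auto
      finally show ?thesis using d by (simp add: dist_norm)
    qed
    have "cmod (poly H l - poly H0 l) \<le> e * S"
      unfolding S_def by (rule poly_perturbation) (use H H0 r in auto)
    also have "\<dots> \<le> T * e" using mult_right_mono[OF T(2), of e] e by (simp add: mult_ac)
    finally have gl: "dist (?g l) l \<le> r / 2"
      using d e H0 by (simp add: dist_norm norm_divide field_simps)
    have "?g ` cball l r \<subseteq> cball l r"
    proof safe
      fix x assume x: "x \<in> cball l r"
      have "dist (?g x) l \<le> dist (?g x) (?g l) + dist (?g l) l" by (rule dist_triangle)
      also have "\<dots> \<le> 1 / 2 * dist x l + r / 2" using g[OF x, of l] gl r by simp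
      also have "\<dots> \<le> r" using x by (simp add: dist_commute)
      finally show "?g x \<in> cball l r" by (simp add: dist_commute)
    qed
    moreover have "complete (cball l r)" "cball l r \<noteq> {}"
      using r by (auto simp: complete_eq_closed)
    ultimately have "\<exists>!x\<in>cball l r. ?g x = x"
      using g by (intro Banach_fix[where c = "1 / 2"]) simp_all
    then obtain x where "x \<in> cball l r" "?g x = x" by blast
    with d show "\<exists>x\<in>cball l r. poly H x = 0" by (intro bexI[of _ x]) auto
  next
    fix H x y assume "degree H \<le> N" "\<And>j. j \<le> N \<Longrightarrow> cmod (coeff H j - coeff H0 j) \<le> e"
      "x \<in> cball l r" "y \<in> cball l r"
    note lip[OF this]
    also have "(poly H x - d * x) - (poly H y - d * y) = (poly H x - poly H y) - d * (x - y)"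
      by (simp add: right_diff_distrib)
    finally have "cmod (d * (x - y)) - cmod (poly H x - poly H y) \<le> cmod d / 2 * cmod (x - y)"
      using norm_triangle_ineq2[of "d * (x - y)" "poly H x - poly H y"]
        norm_minus_commute[of "d * (x - y)" "poly H x - poly H y"] by linarith
    then show "cmod d / 2 * cmod (x - y) \<le> cmod (poly H x - poly H y)"
      by (simp add: norm_mult)
  qed (use r e d in auto)
qed

text \<open>Outside the unit disc the equation bounds \<open>|x|^n\<close> by the coefficient sum
  times \<open>|x|^(n-1)\<close>. The bound confines the roots of all nearby polynomials to one
  compact disc.\<close>

lemma monic_root_bound:
  fixes p :: "complex poly"
  assumes "degree p = n" "lead_coeff p = 1" "poly p x = 0"
  shows "cmod x \<le> 1 + (\<Sum>j<n. cmod (coeff p j))"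
proof (cases "cmod x \<le> 1")
  case True
  then show ?thesis by (simp add: add_increasing2 sum_nonneg)
next
  case False
  have "n \<noteq> 0" using assms by (metis degree_eq_zeroE lead_coeff_pCons(2) poly_const_conv zero_neq_one)
  then obtain m where m: "n = Suc m" by (cases n) auto
  have "x ^ n + (\<Sum>j<n. coeff p j * x ^ j) = 0"
    using assms poly_eq_sum[of p n x] by (simp add: lessThan_Suc_atMost[symmetric] add.commute)
  then have "x ^ n = - (\<Sum>j<n. coeff p j * x ^ j)" by (simp add: eq_neg_iff_add_eq_0)
  then have "cmod x ^ n = cmod (\<Sum>j<n. coeff p j * x ^ j)" by (metis norm_minus_cancel norm_power)
  also have "\<dots> \<le> (\<Sum>j<n. cmod (coeff p j) * cmod x ^ m)"
    using False m by (intro sum_norm_le) (auto simp: norm_mult norm_power intro!: mult_left_mono power_increasing)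
  finally have "cmod x * cmod x ^ m \<le> (\<Sum>j<n. cmod (coeff p j)) * cmod x ^ m"
    by (simp add: m sum_distrib_right distrib_right)
  then have "cmod x \<le> (\<Sum>j<n. cmod (coeff p j))"
    by (rule mult_right_le_imp_le) (use False in \<open>intro zero_less_power, linarith\<close>)
  then show ?thesis by simp
qed

text \<open>On the compact set of possible roots outside \<open>ball l r\<close>, the sum of
  \<open>|P0|\<close> and \<open>|P0'|\<close> has a positive minimum, which a small perturbation
  cannot bring to zero. This excludes membership in the discriminant set through a root far from
  \<open>l\<close>.\<close>

lemma multiple_roots_localized:
  fixes P0 :: "complex poly"
  assumes P0: "degree P0 = n" "lead_coeff P0 = 1"
    and uniq: "\<And>x. poly P0 x = 0 \<Longrightarrow> poly (pderiv P0) x = 0 \<Longrightarrow> x = l" and "0 < r"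
  obtains e where "0 < e"
    "\<And>P x. degree P = n \<Longrightarrow> lead_coeff P = 1 \<Longrightarrow> (\<And>j. j \<le> n \<Longrightarrow> cmod (coeff P j - coeff P0 j) \<le> e) \<Longrightarrow>
       poly P x = 0 \<Longrightarrow> poly (pderiv P) x = 0 \<Longrightarrow> cmod (x - l) < r"
proof -
  \<comment> \<open>The \<open>+ 1\<close> in each summand is room for a coefficient perturbation of
    size \<open>e \<le> 1\<close>.\<close>
  define M where "M = 1 + (\<Sum>j<n. cmod (coeff P0 j) + 1)"
  let ?F = "\<lambda>x. cmod (poly P0 x) + cmod (poly (pderiv P0) x)"
  let ?K = "cball 0 M - ball l r"
  have M: "1 \<le> M" unfolding M_def by (simp add: sum_nonneg add_nonneg_nonneg)
  obtain m where m: "0 < m" "\<And>x. x \<in> ?K \<Longrightarrow> m \<le> ?F x"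
  proof (cases "?K = {}")
    case True
    then have "1 \<le> ?F x" if "x \<in> ?K" for x using that by blast
    then show thesis by (rule that[of 1, OF less_numeral_extra(1)])
  next
    case False
    have "compact ?K" by (intro compact_diff) auto
    moreover have "continuous_on ?K ?F" by (intro continuous_intros)
    ultimately have "\<exists>x\<in>?K. \<forall>y\<in>?K. ?F x \<le> ?F y"
      using False by (intro continuous_attains_inf)
    then obtain x0 where x0: "x0 \<in> ?K" "\<forall>y\<in>?K. ?F x0 \<le> ?F y" by (rule bexE)
    have "x0 \<noteq> l" using x0(1) \<open>0 < r\<close> by auto
    then have "poly P0 x0 \<noteq> 0 \<or> poly (pderiv P0) x0 \<noteq> 0" using uniq by blast
    then have "0 < ?F x0" by (auto intro: add_pos_nonneg add_nonneg_pos)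
    then show thesis by (rule that) (use x0(2) in blast)
  qed
  define S where "S = (\<Sum>j\<le>n. M ^ j)"
  have S: "0 \<le> S" unfolding S_def using M by (intro sum_nonneg) simp
  define e where "e = min 1 (m / (2 * ((n + 1) * S + 1)))"
  have q: "0 < (n + 1) * S + 1" using S by (simp add: add_nonneg_pos)
  have e: "0 < e" "e \<le> 1" using m(1) q by (auto simp: e_def)
  have "e \<le> m / (2 * ((n + 1) * S + 1))" by (simp add: e_def)
  then have "e * (2 * ((n + 1) * S + 1)) \<le> m" using q by (simp only: pos_le_divide_eq mult_pos_pos zero_less_numeral)
  moreover have "0 \<le> (n + 1) * (e * S)" using e S by simp
  ultimately have em: "(n + 1) * (e * S) < m" using e by (simp add: algebra_simps)
  show thesis
  proof
    show "0 < e" by fact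
    fix P x assume P: "degree P = n" "lead_coeff P = 1" "\<And>j. j \<le> n \<Longrightarrow> cmod (coeff P j - coeff P0 j) \<le> e"
      and x: "poly P x = 0" "poly (pderiv P) x = 0"
    have "cmod x \<le> 1 + (\<Sum>j<n. cmod (coeff P j))" using monic_root_bound P x by blast
    also have "\<dots> \<le> M"
    proof -
      have "cmod (coeff P j) \<le> cmod (coeff P0 j) + 1" if "j < n" for j
        using P(3)[of j] that e norm_triangle_ineq2[of "coeff P j" "coeff P0 j"] by simp
      then show ?thesis unfolding M_def by (intro add_left_mono sum_mono) auto
    qed
    finally have xM: "cmod x \<le> M" .
    have "cmod (poly P x - poly P0 x) \<le> e * S"
      unfolding S_def by (rule poly_perturbation) (use P P0 xM in auto)
    moreover have "cmod (poly (pderiv P) x - poly (pderiv P0) x) \<le> n * e * S"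
      unfolding S_def by (rule pderiv_perturbation) (use P P0 xM in auto)
    ultimately have "?F x \<le> (n + 1) * (e * S)" using x by (simp add: algebra_simps)
    then have "x \<notin> ?K" using m(2) em by fastforce
    then show "cmod (x - l) < r" using xM by (auto simp: dist_norm norm_minus_commute)
  qed
qed

subsection \<open>Discriminant sets as graphs at double roots\<close>

lemma coeff_gen_poly:
  "coeff (gen_poly n a) j = (if j = n then 1 else if j < n then a (n - j) else 0)"
proof (cases "j < n")
  case True
  have "(\<Sum>i=1..n. coeff (monom (a i) (n - i)) j) = (\<Sum>i=1..n. if i = n - j then a i else 0)"
    using True by (intro sum.cong) (auto simp: coeff_monom)
  then show ?thesis using True by (simp add: gen_poly_def coeff_sum)
next
  case False
  then show ?thesis using coeff_gen_poly_top[of n a]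
    by (auto simp: gen_poly_def coeff_sum intro!: sum.neutral)
qed

lemma degree_gen_poly [simp]: "degree (gen_poly n a) = n"
  by (intro antisym degree_le le_degree) (auto simp: coeff_gen_poly)

lemma lead_coeff_gen_poly: "lead_coeff (gen_poly n a) = 1"
  by (simp add: coeff_gen_poly)

lemma poly_gen_poly: "poly (gen_poly n a) x = x ^ n + (\<Sum>i=1..n. a i * x ^ (n - i))"
  by (simp add: gen_poly_def poly_sum poly_monom)

lemma gen_poly_update:
  assumes "k \<in> {1..n}"
  shows "gen_poly n (a(k := t)) = gen_poly n (a(k := s)) + monom (t - s) (n - k)"
  using assms by (intro poly_eqI) (auto simp: coeff_gen_poly)

lemma mem_discriminant_set:
  "a \<in> discriminant_set n \<longleftrightarrow> a \<in> cspace {1..n} \<and>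
     (\<exists>x. poly (gen_poly n a) x = 0 \<and> poly (pderiv (gen_poly n a)) x = 0)"
  by (simp add: discriminant_set_iff_multiple_root order_ge_2_iff)

lemma gen_poly_perturbation:
  assumes "\<And>i. i \<in> {1..n} \<Longrightarrow> cmod (a i - b i) \<le> e" "0 \<le> e"
  shows "cmod (coeff (gen_poly n a) j - coeff (gen_poly n b) j) \<le> e"
  using assms by (auto simp: coeff_gen_poly)

section \<open>Elimination of one coefficient at a double root\<close>

lemma pderiv2_nonzero_at_double_root:
  fixes p :: "complex poly"
  assumes "order l p = 2" and p: "p \<noteq> 0"
  shows "poly p l = 0" "poly (pderiv p) l = 0" "poly (pderiv (pderiv p)) l \<noteq> 0"
proof -
  from p assms show 0: "poly p l = 0" "poly (pderiv p) l = 0"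
    using order_ge_2_iff[of p l] by auto
  have "pderiv p \<noteq> 0"
  proof
    assume "pderiv p = 0"
    then obtain c where "p = [:c:]" by (metis pderiv_iszero)
    with 0 p show False by simp
  qed
  moreover from this have "order l p = Suc (order l (pderiv p))"
    using 0 by (intro order_pderiv) auto
  ultimately show "poly (pderiv (pderiv p)) l \<noteq> 0"
    using 0 assms order_ge_2_iff[of "pderiv p" l] by auto
qed

text \<open>Away from \<open>x = 0\<close> the double roots of \<open>P\<close> are those of \<open>P / x\<^sup>m\<close>, \<open>m = n - k\<close>, in which
  \<open>a\<^sub>k\<close> is an additive constant. Hence \<open>x P' - m P\<close>, the numerator of the derivative of this
  quotient, does not involve \<open>a\<^sub>k\<close>. For \<open>k = n\<close> the factor \<open>x\<close> is left out, so that a double root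
  of \<open>P\<close> at \<open>0\<close> stays a simple root.\<close>

definition elim_poly :: "nat \<Rightarrow> nat \<Rightarrow> (nat \<Rightarrow> complex) \<Rightarrow> complex poly" where
  "elim_poly n k a = (if k = n then 1 else [:0, 1:]) * pderiv (gen_poly n a)
     - Polynomial.smult (of_nat (n - k)) (gen_poly n a)"

lemma coeff_elim_poly:
  "coeff (elim_poly n k a) j =
     (if k = n then of_nat (Suc j) * coeff (gen_poly n a) (Suc j)
      else (of_nat j - of_nat (n - k)) * coeff (gen_poly n a) j)"
  by (cases j) (auto simp: elim_poly_def coeff_pderiv left_diff_distrib)

lemma degree_elim_poly: "degree (elim_poly n k a) \<le> n"
  by (intro degree_le) (auto simp: coeff_elim_poly coeff_gen_poly)

text \<open>The coefficient \<open>a k\<close> sits at degree \<open>n - k\<close>, where the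
  multiplier \<open>j - (n - k)\<close> is zero; for \<open>k = n\<close> differentiation removes
  it.\<close>

lemma elim_poly_cong:
  assumes "\<And>i. i \<in> {1..n} - {k} \<Longrightarrow> a i = b i" "k \<in> {1..n}"
  shows "elim_poly n k a = elim_poly n k b"
proof (rule poly_eqI)
  fix j
  show "coeff (elim_poly n k a) j = coeff (elim_poly n k b) j"
  proof (cases "k = n")
    case True
    have "a (n - Suc j) = b (n - Suc j)" if "Suc j < n"
      by (rule assms(1)) (use that True in auto)
    then have "coeff (gen_poly n a) (Suc j) = coeff (gen_poly n b) (Suc j)"
      by (auto simp: coeff_gen_poly)
    then show ?thesis using True by (simp add: coeff_elim_poly)
  next
    case False
    show ?thesis
    proof (cases "j = n - k")
      case j: False
      have "a (n - j) = b (n - j)" if "j < n"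
        by (rule assms(1)) (use that j in auto)
      then have "coeff (gen_poly n a) j = coeff (gen_poly n b) j"
        by (auto simp: coeff_gen_poly)
      then show ?thesis using False by (simp add: coeff_elim_poly)
    qed (use False in \<open>simp add: coeff_elim_poly\<close>)
  qed
qed

lemma elim_poly_perturbation:
  assumes "\<And>i. i \<in> {1..n} - {k} \<Longrightarrow> cmod (a i - b i) \<le> e" "0 \<le> e" "k \<in> {1..n}" "j \<le> n"
  shows "cmod (coeff (elim_poly n k a) j - coeff (elim_poly n k b) j) \<le> n * e"
proof -
  \<comment> \<open>Nothing is known about \<open>a k - b k\<close>, so \<open>a k\<close> is first
    replaced by \<open>b k\<close>.\<close>
  have "elim_poly n k a = elim_poly n k (a(k := b k))"
    by (rule elim_poly_cong) (use assms in auto)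
  moreover define a' where "a' = a(k := b k)"
  moreover have g: "cmod (coeff (gen_poly n a') i - coeff (gen_poly n b) i) \<le> e" for i
    by (rule gen_poly_perturbation) (use assms in \<open>auto simp: a'_def\<close>)
  have "cmod (coeff (elim_poly n k a') j - coeff (elim_poly n k b) j) \<le> n * e"
  proof (cases "k = n")
    case True
    show ?thesis
    proof (cases "Suc j \<le> n")
      case S: True
      have "cmod (coeff (elim_poly n k a') j - coeff (elim_poly n k b) j)
          = cmod (of_nat (Suc j) * (coeff (gen_poly n a') (Suc j) - coeff (gen_poly n b) (Suc j)))"
        using True by (simp only: coeff_elim_poly right_diff_distrib simp_thms if_True)
      also have "\<dots> = Suc j * cmod (coeff (gen_poly n a') (Suc j) - coeff (gen_poly n b) (Suc j))"
        by (simp only: norm_mult norm_of_nat)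
      also have "\<dots> \<le> n * e" using S g assms(2) by (intro mult_mono) auto
      finally show ?thesis .
    qed (use True assms(2) in \<open>simp add: coeff_elim_poly coeff_gen_poly\<close>)
  next
    case False
    have "cmod (coeff (elim_poly n k a') j - coeff (elim_poly n k b) j)
        = cmod (of_int (int j - int (n - k)) * (coeff (gen_poly n a') j - coeff (gen_poly n b) j))"
      using False by (simp add: coeff_elim_poly right_diff_distrib)
    also have "\<dots> = \<bar>real_of_int (int j - int (n - k))\<bar> * cmod (coeff (gen_poly n a') j - coeff (gen_poly n b) j)"
      by (simp only: norm_mult norm_of_int)
    also have "\<dots> \<le> n * e" using assms(2,4) g by (intro mult_mono) auto
    finally show ?thesis .
  qed
  ultimately show ?thesis by simp
qed

lemma poly_elim_poly:
  "poly (elim_poly n k a) x = (if k = n then 1 else x) * poly (pderiv (gen_poly n a)) x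
     - of_nat (n - k) * poly (gen_poly n a) x"
  by (simp add: elim_poly_def)

text \<open>At the double root the derivative of \<open>x P' - m P\<close> is
  \<open>l P''(l)\<close>, and for \<open>k = n\<close> it is \<open>P''(l)\<close>. This is where
  \<open>l \<noteq> 0 \<or> k = n\<close> enters.\<close>

lemma elim_poly_simple_root:
  assumes "order l (gen_poly n a) = 2" "l \<noteq> 0 \<or> k = n"
  shows "poly (elim_poly n k a) l = 0" "poly (pderiv (elim_poly n k a)) l \<noteq> 0"
  using pderiv2_nonzero_at_double_root[OF assms(1) gen_poly_nonzero] assms(2)
  by (auto simp: elim_poly_def pderiv_diff pderiv_smult pderiv_mult pderiv_pCons)

lemma double_root_factor:
  fixes p :: "complex poly"
  assumes "poly p x = 0" "poly (pderiv p) x = 0"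
  obtains s where "p = [:-x, 1:] ^ 2 * s"
proof (cases "p = 0")
  case False
  then have "2 \<le> order x p" using assms order_ge_2_iff by blast
  then have "[:-x, 1:] ^ 2 dvd p" by (metis order_divides)
  then show thesis using that by (metis dvdE)
qed (use that[of 0] in simp)

text \<open>The lower Lipschitz bound makes \<open>X z\<close> the only root of the eliminated
  polynomial near \<open>l\<close>, and localization sends every multiple root of a nearby
  polynomial there. Membership in the discriminant set thus becomes one equation for
  \<open>a k\<close>.\<close>

lemma locally_graph_at_double_root:
  assumes k: "k \<in> {1..n}" and A: "A \<in> cspace {1..n}"
    and l: "order l (gen_poly n A) = 2" "l \<noteq> 0 \<or> k = n"
    and uniq: "\<And>x. poly (gen_poly n A) x = 0 \<Longrightarrow> poly (pderiv (gen_poly n A)) x = 0 \<Longrightarrow> x = l"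
  shows "locally_graph_at n k (discriminant_set n) A"
proof -
  define I where "I = {1..n} - {k}"
  define m where "m = n - k"
  have I: "finite I" "insert k I = {1..n}" "k \<notin> I" using k by (auto simp: I_def)
  \<comment> \<open>The radius \<open>|l|/2\<close> keeps the disc away from 0, so that
    \<open>x ^ m\<close> can be divided by; \<open>l = 0\<close> occurs only with
    \<open>k = n\<close>, where \<open>m = 0\<close>.\<close>
  have "0 < (if l = 0 then 1 else cmod l / 2)" by simp
  then obtain r e1 c where r: "0 < r" "r \<le> (if l = 0 then 1 else cmod l / 2)" and e1: "0 < e1" and c: "0 < c"
    and ex: "\<And>H. degree H \<le> n \<Longrightarrow> (\<And>j. j \<le> n \<Longrightarrow> cmod (coeff H j - coeff (elim_poly n k A) j) \<le> e1)
        \<Longrightarrow> \<exists>x\<in>cball l r. poly H x = 0"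
    and lip: "\<And>H x y. degree H \<le> n \<Longrightarrow> (\<And>j. j \<le> n \<Longrightarrow> cmod (coeff H j - coeff (elim_poly n k A) j) \<le> e1)
        \<Longrightarrow> x \<in> cball l r \<Longrightarrow> y \<in> cball l r \<Longrightarrow> c * cmod (x - y) \<le> cmod (poly H x - poly H y)"
    apply (rule simple_root_stable[OF elim_poly_simple_root[OF l] degree_elim_poly])
    subgoal premises p for r e1 c by (rule p(1)[of r e1 c, OF p(2-)])
    done
  have nz: "x ^ m \<noteq> 0" "(if k = n then 1 else x) \<noteq> 0" if "x \<in> cball l r" for x
  proof -
    have "k = n \<or> x \<noteq> 0" using that r l by (auto split: if_splits)
    then show "x ^ m \<noteq> 0" "(if k = n then 1 else x) \<noteq> 0" by (auto simp: m_def)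
  qed
  obtain e2 where e2: "0 < e2" and loc:
    "\<And>P x. degree P = n \<Longrightarrow> lead_coeff P = 1 \<Longrightarrow>
       (\<And>j. j \<le> n \<Longrightarrow> cmod (coeff P j - coeff (gen_poly n A) j) \<le> e2) \<Longrightarrow>
       poly P x = 0 \<Longrightarrow> poly (pderiv P) x = 0 \<Longrightarrow> cmod (x - l) < r"
    apply (rule multiple_roots_localized[OF degree_gen_poly lead_coeff_gen_poly uniq r(1)])
      apply assumption+
    subgoal premises p for e by (rule p(1)[of e, OF p(2-)])
    done
  have n: "0 < n" using k by auto
  define W0 where "W0 = {z \<in> cspace I. \<forall>i\<in>I. cmod (z i - A i) < e1 / n}"
  have W0_open: "openin (ctop I) W0" unfolding W0_def by (intro openin_ctop_box I)
  have near: "cmod (coeff (elim_poly n k z) j - coeff (elim_poly n k A) j) \<le> e1" if "z \<in> W0" "j \<le> n" for z j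
  proof -
    have "cmod (coeff (elim_poly n k z) j - coeff (elim_poly n k A) j) \<le> n * (e1 / n)"
      by (rule elim_poly_perturbation) (use that k e1 in \<open>auto simp: W0_def I_def less_imp_le\<close>)
    then show ?thesis using n by simp
  qed
  define X where "X z = (SOME x. x \<in> cball l r \<and> poly (elim_poly n k z) x = 0)" for z
  have X: "X z \<in> cball l r" "poly (elim_poly n k z) (X z) = 0" if "z \<in> W0" for z
    using someI_ex[of "\<lambda>x. x \<in> cball l r \<and> poly (elim_poly n k z) x = 0"]
      ex[OF degree_elim_poly near[OF that]] unfolding X_def by blast+
  have X_eq: "x = X z" if "z \<in> W0" "x \<in> cball l r" "poly (elim_poly n k z) x = 0" for z x
    using lip[OF degree_elim_poly near[OF that(1)] that(2) X(1)[OF that(1)]] that X[OF that(1)] c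
    by (simp add: mult_le_0_iff)
  \<comment> \<open>\<open>P(x)\<close> is affine in \<open>a k\<close> with slope
    \<open>x ^ m\<close>; this is the solution of \<open>P(x) = 0\<close> for \<open>a k\<close>,
    with 0 as a placeholder in that coordinate.\<close>
  define f where "f z = - poly (gen_poly n (z(k := 0))) (X z) / X z ^ m" for z
  have upd: "poly (gen_poly n (z(k := t))) x = poly (gen_poly n (z(k := 0))) x + t * x ^ m" for z t x
    using gen_poly_update[OF k, of z t 0] by (simp add: poly_monom m_def)
  have elim_upd: "elim_poly n k (z(k := t)) = elim_poly n k z" for z t
    by (rule elim_poly_cong) (use k in auto)
  have root: "poly (gen_poly n (z(k := f z))) (X z) = 0" if "z \<in> W0" for z
    using nz(1)[OF X(1)[OF that]] by (subst upd) (simp add: f_def)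
  have root': "poly (pderiv (gen_poly n (z(k := f z)))) (X z) = 0" if "z \<in> W0" for z
  proof -
    have "poly (elim_poly n k (z(k := f z))) (X z) = 0" using X(2)[OF that] by (simp add: elim_upd)
    then show ?thesis using nz(2)[OF X(1)[OF that]] root[OF that] by (simp add: poly_elim_poly split: if_splits)
  qed
  have grad: "has_gradient I f W0 w (\<lambda>i. - (X w ^ (n - i) / X w ^ m))" if w: "w \<in> W0" for w
    unfolding has_gradient_def
  proof (intro allI impI)
    fix \<epsilon> :: real assume "0 < \<epsilon>"
    define x where "x = X w"
    have x: "x \<in> cball l r" "x ^ m \<noteq> 0" using X[OF w] nz by (auto simp: x_def)
    define Pw where "Pw = gen_poly n (w(k := f w))"
    obtain S where S: "Pw = [:-x, 1:] ^ 2 * S"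
      using double_root_factor root[OF w] root'[OF w] unfolding Pw_def x_def by metis
    define C where "C = n * (\<Sum>j\<le>n. cmod x ^ j) / c"
    have C: "0 \<le> C" using c by (simp add: C_def sum_nonneg)
    have XC: "cmod (X z - x) \<le> C * cdist I z w" if z: "z \<in> W0" for z
    proof -
      have "c * cmod (X z - x) \<le> cmod (poly (elim_poly n k z) (X z) - poly (elim_poly n k z) x)"
        by (rule lip[OF degree_elim_poly near[OF z] X(1)[OF z] x(1)])
      also have "\<dots> = cmod (poly (elim_poly n k z) x - poly (elim_poly n k w) x)"
        using X(2)[OF z] X(2)[OF w] by (simp add: x_def)
      also have "\<dots> \<le> n * cdist I z w * (\<Sum>j\<le>n. cmod x ^ j)"
        by (rule poly_perturbation[OF degree_elim_poly degree_elim_poly elim_poly_perturbation])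
          (use k norm_le_cdist[OF I(1)] in \<open>auto simp: I_def\<close>)
      finally show ?thesis using c by (simp add: C_def field_simps)
    qed
    \<comment> \<open>The error divided by \<open>cdist\<close>: the variation of the claimed
      gradient, and the remainder of the double root, where one of the two factors
      \<open>y - x\<close> has been estimated by \<open>C * cdist\<close>. It is continuous and zero
      at \<open>x\<close>.\<close>
    define G where "G y = (\<Sum>i\<in>I. cmod (x ^ (n - i) / x ^ m - y ^ (n - i) / y ^ m))
        + C * cmod (y - x) * cmod (poly S y / y ^ m)" for y
    have "isCont G x" unfolding G_def using x(2) by (intro continuous_intros) auto
    moreover have "G x = 0" by (simp add: G_def)
    ultimately obtain \<delta> where \<delta>: "0 < \<delta>" "\<And>y. cmod (y - x) < \<delta> \<Longrightarrow> \<bar>G y\<bar> < \<epsilon>"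
      using \<open>0 < \<epsilon>\<close> unfolding continuous_at_eps_delta dist_norm by (metis diff_zero real_norm_def)
    show "\<exists>d>0. \<forall>z\<in>W0. cdist I z w < d \<longrightarrow>
        cmod (f z - f w - (\<Sum>i\<in>I. - (X w ^ (n - i) / X w ^ m) * (z i - w i))) \<le> \<epsilon> * cdist I z w"
    proof (intro exI[of _ "\<delta> / (C + 1)"] conjI ballI impI)
      show "0 < \<delta> / (C + 1)" using \<delta> C by simp
      fix z assume z: "z \<in> W0" and d: "cdist I z w < \<delta> / (C + 1)"
      define y where "y = X z"
      have y: "y ^ m \<noteq> 0" using X[OF z] nz by (auto simp: y_def)
      have "(C + 1) * cdist I z w < \<delta>" using d C by (simp add: pos_less_divide_eq mult.commute)
      then have "C * cdist I z w < \<delta>" by (simp add: distrib_right) (use cdist_nonneg[of I z w] in linarith)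
      then have yx: "cmod (y - x) < \<delta>" using XC[OF z] by (simp add: y_def)
      \<comment> \<open>Evaluating both polynomials at the same point \<open>y\<close> leaves only
        coefficient differences; the motion of the root enters through \<open>Pw\<close> at
        \<open>y\<close>, which is of second order.\<close>
      have "poly (gen_poly n (z(k := f z))) y - poly Pw y
          = (\<Sum>i\<in>insert k I. ((z(k := f z)) i - (w(k := f w)) i) * y ^ (n - i))"
        by (simp only: Pw_def poly_gen_poly I(2) left_diff_distrib sum_subtractf add_diff_cancel_left)
      also have "\<dots> = (f z - f w) * y ^ m + (\<Sum>i\<in>I. (z i - w i) * y ^ (n - i))"
        using I by (subst sum.insert) (auto simp: m_def intro!: sum.cong)
      finally have "(f z - f w) * y ^ m = - (\<Sum>i\<in>I. (z i - w i) * y ^ (n - i)) - poly Pw y"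
        using root[OF z] by (simp add: y_def algebra_simps eq_neg_iff_add_eq_0)
      then have "f z - f w = - ((\<Sum>i\<in>I. (z i - w i) * y ^ (n - i)) / y ^ m) - poly Pw y / y ^ m"
        using y by (metis diff_divide_distrib minus_divide_left nonzero_mult_div_cancel_right)
      also have "(\<Sum>i\<in>I. (z i - w i) * y ^ (n - i)) / y ^ m = (\<Sum>i\<in>I. (z i - w i) * (y ^ (n - i) / y ^ m))"
        by (simp add: sum_divide_distrib)
      finally have E: "f z - f w - (\<Sum>i\<in>I. - (X w ^ (n - i) / X w ^ m) * (z i - w i))
          = (\<Sum>i\<in>I. (z i - w i) * (x ^ (n - i) / x ^ m - y ^ (n - i) / y ^ m)) - poly Pw y / y ^ m"
        by (simp add: x_def right_diff_distrib sum_subtractf sum_negf mult.commute)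
      have "cmod (\<Sum>i\<in>I. (z i - w i) * (x ^ (n - i) / x ^ m - y ^ (n - i) / y ^ m))
          \<le> (\<Sum>i\<in>I. cdist I z w * cmod (x ^ (n - i) / x ^ m - y ^ (n - i) / y ^ m))"
        using norm_le_cdist[OF I(1)] by (intro sum_norm_le) (auto simp: norm_mult intro!: mult_right_mono)
      moreover have Sy: "poly Pw y = (y - x) ^ 2 * poly S y"
        by (simp add: S power2_eq_square algebra_simps)
      have "cmod (poly Pw y / y ^ m) = cmod (y - x) * (cmod (y - x) * cmod (poly S y / y ^ m))"
        unfolding Sy by (simp only: norm_mult norm_divide power2_eq_square times_divide_eq_right mult.assoc)
      moreover have "\<dots> \<le> C * cdist I z w * (cmod (y - x) * cmod (poly S y / y ^ m))"
        using XC[OF z] by (intro mult_right_mono) (auto simp: y_def)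
      ultimately have "cmod (f z - f w - (\<Sum>i\<in>I. - (X w ^ (n - i) / X w ^ m) * (z i - w i)))
          \<le> (\<Sum>i\<in>I. cdist I z w * cmod (x ^ (n - i) / x ^ m - y ^ (n - i) / y ^ m))
            + C * cdist I z w * (cmod (y - x) * cmod (poly S y / y ^ m))"
        unfolding E by (intro order_trans[OF norm_triangle_ineq4]) linarith
      also have "\<dots> = G y * cdist I z w"
        unfolding G_def sum_distrib_left[symmetric] by (simp add: algebra_simps)
      also have "\<dots> \<le> \<epsilon> * cdist I z w"
        using \<delta>(2)[OF yx] by (intro mult_right_mono) auto
      finally show "cmod (f z - f w - (\<Sum>i\<in>I. - (X w ^ (n - i) / X w ^ m) * (z i - w i))) \<le> \<epsilon> * cdist I z w" .
    qed
  qed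
  define w0 where "w0 = omit n k A"
  have w0: "w0 \<in> W0" "w0(k := t) = A(k := t)" "\<And>i. i \<in> I \<Longrightarrow> w0 i = A i" for t
    using A k e1 n by (auto simp: W0_def w0_def omit_def I_def PiE_iff extensional_def fun_eq_iff)
  have "X w0 = l"
  proof -
    have "elim_poly n k w0 = elim_poly n k A" by (rule elim_poly_cong) (use w0 k in \<open>auto simp: I_def\<close>)
    then show ?thesis using X_eq[OF w0(1), of l] elim_poly_simple_root[OF l] r by simp
  qed
  then have f0: "f w0 = A k"
    using upd[of w0 "A k" l] w0(2)[of "A k"] pderiv2_nonzero_at_double_root(1)[OF l(1) gen_poly_nonzero]
      nz(1)[of l] r by (simp add: f_def field_simps neg_eq_iff_add_eq_0 add.commute)
  obtain d where d: "0 < d" "\<And>z. z \<in> W0 \<Longrightarrow> (\<And>i. i \<in> I \<Longrightarrow> cmod (z i - w0 i) < d) \<Longrightarrow> cmod (f z - f w0) < e2"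
    apply (rule has_gradient_continuous[OF grad[OF w0(1)] I(1) e2])
    subgoal premises p for d by (rule p(1)[of d, OF p(2-)])
    done
  \<comment> \<open>The bound \<open>d\<close> keeps the values of \<open>f\<close> in
    \<open>ball (A k) e2\<close>; the bound \<open>e2\<close> keeps the other coefficients within
    reach of localization.\<close>
  define W where "W = W0 \<inter> {z \<in> cspace I. \<forall>i\<in>I. cmod (z i - A i) < min d e2}"
  have W: "openin (ctop I) W" unfolding W_def by (intro openin_Int W0_open openin_ctop_box I)
  show ?thesis
    unfolding locally_graph_at_def I_def[symmetric]
  proof (intro exI[of _ W] exI[of _ "ball (A k) e2"] exI[of _ f] conjI ballI impI)
    show "omit n k A \<in> W" using w0 d e2 by (auto simp: W_def W0_def w0_def[symmetric])
    show "holomorphic_in I f W"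
      unfolding holomorphic_in_iff_gradient
    proof (intro conjI ballI W)
      fix w assume "w \<in> W"
      then have "w \<in> W0" by (simp add: W_def)
      moreover have "W \<subseteq> W0" by (auto simp: W_def)
      ultimately show "\<exists>c. has_gradient I f W w c" using has_gradient_subset[OF grad] by blast
    qed
    show "f ` W \<subseteq> ball (A k) e2"
      using d(2) w0(3) f0 by (auto simp: W_def dist_norm norm_minus_commute)
    fix a assume a: "a \<in> cspace {1..n}" and "omit n k a \<in> W \<and> a k \<in> ball (A k) e2"
    moreover define z where "z = omit n k a"
    ultimately have z: "z \<in> W" "z \<in> W0" and ak: "cmod (a k - A k) < e2"
      by (auto simp: W_def dist_norm norm_minus_commute)
    have az: "z(k := a k) = a"
      using a by (auto simp: z_def omit_def fun_eq_iff PiE_iff extensional_def)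
    have "a \<in> discriminant_set n \<longleftrightarrow> a k = f z"
    proof
      assume "a \<in> discriminant_set n"
      then obtain x where x: "poly (gen_poly n a) x = 0" "poly (pderiv (gen_poly n a)) x = 0"
        by (auto simp: mem_discriminant_set)
      have "cmod (a i - A i) \<le> e2" if "i \<in> {1..n}" for i
        using that ak z(1) az by (cases "i = k") (auto simp: W_def I_def z_def omit_def less_imp_le)
      then have "cmod (x - l) < r"
        using e2 by (intro loc[OF degree_gen_poly lead_coeff_gen_poly gen_poly_perturbation x]) auto
      then have xr: "x \<in> cball l r" by (simp add: dist_norm norm_minus_commute)
      have "poly (elim_poly n k z) x = 0"
        using x by (simp add: elim_upd[of z "a k", unfolded az, symmetric] poly_elim_poly)
      then have xX: "x = X z" using X_eq[OF z(2) xr] by simp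
      show "a k = f z"
        using x(1) upd[of z "a k" x] nz(1)[OF xr] unfolding az
        by (simp add: f_def xX[symmetric] field_simps eq_neg_iff_add_eq_0)
    next
      assume "a k = f z"
      then show "a \<in> discriminant_set n"
        using root[OF z(2)] root'[OF z(2)] a az by (auto simp: mem_discriminant_set)
    qed
    then show "a \<in> discriminant_set n \<longleftrightarrow> a k = f (omit n k a)" by (simp add: z_def)
  qed (use W e2 in auto)
qed

text \<open>If \<open>a\<^sub>k\<close> were a differentiable function of the other coefficients, then moving \<open>a\<^sub>n\<close> by \<open>t\<close> would
  move \<open>a\<^sub>k\<close> by \<open>O(t)\<close> and, by the equation \<open>P' = 0\<close>, the double root by \<open>O(t)\<close>; then \<open>P = 0\<close> at this
  root reads \<open>t + o(t) = 0\<close>.\<close>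

lemma not_locally_graph_at_zero:
  assumes k: "k \<in> {1..n-1}" and A: "A \<in> cspace {1..n}"
    and ord: "order 0 (gen_poly n A) = 2"
    and uniq: "\<And>x. poly (gen_poly n A) x = 0 \<Longrightarrow> poly (pderiv (gen_poly n A)) x = 0 \<Longrightarrow> x = 0"
  shows "\<not> locally_graph_at n k (discriminant_set n) A"
proof
  define I where "I = {1..n} - {k}"
  define m where "m = n - k"
  have I: "finite I" "n \<in> I" "k \<noteq> n" "k \<in> {1..n}" and m: "0 < m" using k by (auto simp: I_def m_def)
  define w where "w = omit n k A"
  assume "locally_graph_at n k (discriminant_set n) A"
  then obtain W V f where W: "openin (ctop I) W" "w \<in> W" and V: "open V" "A k \<in> V"
    and f: "holomorphic_in I f W" "f ` W \<subseteq> V"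
    and graph: "\<And>a. a \<in> cspace {1..n} \<Longrightarrow> omit n k a \<in> W \<Longrightarrow> a k \<in> V \<Longrightarrow>
        a \<in> discriminant_set n \<longleftrightarrow> a k = f (omit n k a)"
    unfolding locally_graph_at_def I_def w_def by blast
  obtain c where c: "has_gradient I f W w c"
    using f(1) W(2) unfolding holomorphic_in_iff_gradient by blast
  note A0 = pderiv2_nonzero_at_double_root[OF ord gen_poly_nonzero]
  have fw: "f w = A k"
    using graph[OF A] W(2) V(2) A A0 by (auto simp: w_def mem_discriminant_set)
  have wi: "w i = A i" if "i \<in> I" for i using that by (simp add: w_def omit_def I_def)
  have w_ext: "w \<in> cspace I" using W openin_ctop_subset by blast
  define t where "t j = (1 / of_nat (Suc j) :: complex)" for j
  have t0: "t \<longlonglongrightarrow> 0" "t j \<noteq> 0" for j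
    unfolding t_def using LIMSEQ_Suc[OF lim_1_over_n[where 'a = complex]] by (auto simp del: of_nat_Suc)
  \<comment> \<open>At \<open>x = 0\<close> the coefficient \<open>a_n\<close> alone determines the
    value of \<open>P\<close>, and \<open>k < n\<close> leaves it among the free variables.\<close>
  define z where "z j = w(n := w n + t j)" for j
  have zi: "((\<lambda>j. z j i) \<longlonglongrightarrow> w i)" for i
    unfolding z_def by (cases "i = n") (auto intro!: tendsto_eq_intros t0)
  have z_ext: "z j \<in> cspace I" for j
    using w_ext I(2) by (auto simp: z_def PiE_iff extensional_def)
  obtain e where e: "0 < e" "\<And>z. z \<in> cspace I \<Longrightarrow> (\<And>i. i \<in> I \<Longrightarrow> cmod (z i - w i) < e) \<Longrightarrow> z \<in> W"
    using openin_ctop_contains_box[OF I(1) W] by blast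
  have "\<forall>\<^sub>F j in sequentially. \<forall>i\<in>I. cmod (z j i - w i) < e"
    using I(1) zi e(1) by (intro eventually_ball_finite) (auto simp: tendsto_iff dist_norm)
  then have zW: "\<forall>\<^sub>F j in sequentially. z j \<in> W"
    by eventually_elim (use e z_ext in auto)
  define \<delta> where "\<delta> j = (f (z j) - f w) / t j" for j
  have "\<delta> \<longlonglongrightarrow> (\<Sum>i\<in>I. c i * (if i = n then 1 else 0))"
    unfolding \<delta>_def
  proof (rule has_gradient_along[OF c I(1) zW t0(1)])
    fix i show "(\<lambda>j. (z j i - w i) / t j) \<longlonglongrightarrow> (if i = n then 1 else 0)"
      using t0(2) by (simp add: z_def)
  qed (use t0 in simp)
  then have \<delta>: "\<delta> \<longlonglongrightarrow> c n" using I(1,2) by (simp add: if_distrib cong: if_cong)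
  have fz: "f (z j) = A k + t j * \<delta> j" for j using t0(2) by (simp add: \<delta>_def fw)
  define a where "a j = (z j)(k := f (z j))" for j
  have a_ext: "a j \<in> cspace {1..n}" for j
    using z_ext[of j] k by (auto simp: a_def I_def PiE_iff extensional_def)
  have omit_a: "omit n k (a j) = z j" for j
    using z_ext[of j] by (auto simp: a_def omit_def I_def PiE_iff extensional_def fun_eq_iff)
  define \<mu> where "\<mu> j = (SOME x. poly (gen_poly n (a j)) x = 0 \<and> poly (pderiv (gen_poly n (a j))) x = 0)" for j
  have \<mu>: "\<forall>\<^sub>F j in sequentially. poly (gen_poly n (a j)) (\<mu> j) = 0 \<and> poly (pderiv (gen_poly n (a j))) (\<mu> j) = 0"
    using zW
  proof eventually_elim
    case (elim j)
    have "a j k = f (z j)" by (simp add: a_def)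
    moreover from this have "a j k \<in> V" using f(2) elim by blast
    ultimately have "a j \<in> discriminant_set n"
      using graph[OF a_ext, of j] elim unfolding omit_a by blast
    then have "\<exists>x. poly (gen_poly n (a j)) x = 0 \<and> poly (pderiv (gen_poly n (a j))) x = 0"
      unfolding mem_discriminant_set by (rule conjunct2)
    from someI_ex[OF this] show ?case unfolding \<mu>_def .
  qed
  have "(\<lambda>j. A k + t j * \<delta> j) \<longlonglongrightarrow> A k + 0 * c n" by (intro tendsto_intros t0(1) \<delta>)
  then have ai: "(\<lambda>j. a j i) \<longlonglongrightarrow> A i" if "i \<in> {1..n}" for i
  proof (cases "i = k")
    case False
    with that have "i \<in> I" by (simp add: I_def)
    with False zi[of i] wi[of i] show ?thesis by (simp add: a_def)
  qed (simp add: a_def fz)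
  have \<mu>0: "\<mu> \<longlonglongrightarrow> 0"
  proof (rule tendstoI)
    fix r :: real assume r: "0 < r"
    obtain e where e: "0 < e" and loc: "\<And>P x. degree P = n \<Longrightarrow> lead_coeff P = 1 \<Longrightarrow>
       (\<And>j. j \<le> n \<Longrightarrow> cmod (coeff P j - coeff (gen_poly n A) j) \<le> e) \<Longrightarrow>
       poly P x = 0 \<Longrightarrow> poly (pderiv P) x = 0 \<Longrightarrow> cmod (x - 0) < r"
      apply (rule multiple_roots_localized[OF degree_gen_poly lead_coeff_gen_poly uniq r])
        apply assumption+
      subgoal premises p for e by (rule p(1)[of e, OF p(2-)])
      done
    have "\<forall>\<^sub>F j in sequentially. \<forall>i\<in>{1..n}. cmod (a j i - A i) < e"
      using ai e by (intro eventually_ball_finite) (auto simp: tendsto_iff dist_norm)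
    with \<mu> show "\<forall>\<^sub>F j in sequentially. dist (\<mu> j) 0 < r"
    proof eventually_elim
      case (elim j)
      have "cmod (\<mu> j - 0) < r"
        by (rule loc[OF degree_gen_poly lead_coeff_gen_poly gen_poly_perturbation])
          (use elim e in \<open>auto simp: less_imp_le\<close>)
      then show ?case by simp
    qed
  qed
  have a_eq: "a j i = (if i = k then A k + t j * \<delta> j else if i = n then A n + t j else A i)" if "i \<in> {1..n}" for i j
    using that wi[of i] by (cases "i = k") (auto simp: I_def a_def fz, auto simp: z_def)
  have "gen_poly n (a j) = gen_poly n A + monom (t j) 0 + monom (t j * \<delta> j) m" for j
  proof (rule poly_eqI)
    fix i
    show "coeff (gen_poly n (a j)) i = coeff (gen_poly n A + monom (t j) 0 + monom (t j * \<delta> j) m) i"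
      using I(3,4) a_eq[of "n - i"] a_eq[of n]
      by (cases "i < n"; cases "i = 0"; cases "i = m") (auto simp: coeff_gen_poly m_def)
  qed
  then have P: "poly (gen_poly n (a j)) x = poly (gen_poly n A) x + t j + t j * \<delta> j * x ^ m"
    and P': "poly (pderiv (gen_poly n (a j))) x = poly (pderiv (gen_poly n A)) x + of_nat m * (t j * \<delta> j) * x ^ (m - 1)"
    for j x
    by (simp_all add: poly_monom pderiv_add pderiv_monom)
  obtain Q where Q: "gen_poly n A = [:-0, 1:] ^ 2 * Q"
    using double_root_factor[OF A0(1,2)] by blast
  \<comment> \<open>With \<open>P = x^2 Q\<close> at \<open>A\<close>, the derivative is
    \<open>x U\<close>, and \<open>U 0 = 2 Q(0)\<close> is nonzero because the root is exactly
    double.\<close>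
  define U where "U x = 2 * poly Q x + x * poly (pderiv Q) x" for x
  have PQ: "poly (gen_poly n A) x = x * (x * poly Q x)" for x by (simp add: Q power2_eq_square)
  have PU: "poly (pderiv (gen_poly n A)) x = x * U x" for x
    by (simp add: Q U_def power2_eq_square pderiv_mult pderiv_pCons algebra_simps)
  have "gen_poly n A = [:0, 1:] * ([:0, 1:] * Q)" by (simp add: Q power2_eq_square)
  then have "poly (pderiv (pderiv (gen_poly n A))) 0 = 2 * poly Q 0"
    by (simp add: pderiv_mult pderiv_pCons pderiv_add)
  then have U0: "U 0 \<noteq> 0" using A0(3) by (simp add: U_def)
  have lim: "(\<lambda>j. U (\<mu> j)) \<longlonglongrightarrow> U 0" "(\<lambda>j. poly Q (\<mu> j)) \<longlonglongrightarrow> poly Q 0"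
    unfolding U_def by (intro tendsto_intros \<mu>0 isCont_tendsto_compose[where g = "poly _"]; simp)+
  have U_ev: "\<forall>\<^sub>F j in sequentially. U (\<mu> j) \<noteq> 0"
    using tendsto_imp_eventually_ne[OF lim(1) U0] .
  \<comment> \<open>The value of \<open>\<mu> j / t j\<close> obtained from \<open>P' = 0\<close>.
    Its convergence expresses that the root moves by \<open>O(t)\<close>.\<close>
  define \<rho> where "\<rho> j = - (of_nat m * \<delta> j * \<mu> j ^ (m - 1)) / U (\<mu> j)" for j
  have \<rho>: "\<rho> \<longlonglongrightarrow> - (of_nat m * c n * 0 ^ (m - 1)) / U 0"
    unfolding \<rho>_def by (intro tendsto_intros \<delta> \<mu>0 lim U0)
  have "\<forall>\<^sub>F j in sequentially. \<rho> j * \<mu> j * poly Q (\<mu> j) + 1 + \<delta> j * \<mu> j ^ m = 0"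
    using \<mu> U_ev
  proof eventually_elim
    case (elim j)
    have "\<mu> j * U (\<mu> j) + of_nat m * (t j * \<delta> j) * \<mu> j ^ (m - 1) = 0"
      using elim by (simp add: P' PU)
    then have \<mu>\<rho>: "\<mu> j = t j * \<rho> j"
      using elim(2) by (simp add: \<rho>_def field_simps eq_neg_iff_add_eq_0)
    \<comment> \<open>Dividing this equation by \<open>t j\<close> leaves \<open>1\<close> plus
      terms that tend to 0; for the last one this needs \<open>m > 0\<close>.\<close>
    have "0 = poly (gen_poly n (a j)) (\<mu> j)" using elim by simp
    also have "\<dots> = \<mu> j * (\<mu> j * poly Q (\<mu> j)) + t j + t j * \<delta> j * \<mu> j ^ m" by (simp only: P PQ)
    also have "\<mu> j * (\<mu> j * poly Q (\<mu> j)) = t j * \<rho> j * (\<mu> j * poly Q (\<mu> j))" using \<mu>\<rho> by simp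
    also have "\<dots> + t j + t j * \<delta> j * \<mu> j ^ m = t j * (\<rho> j * \<mu> j * poly Q (\<mu> j) + 1 + \<delta> j * \<mu> j ^ m)"
      by (simp add: algebra_simps)
    finally show ?case using t0(2)[of j] by simp
  qed
  then have "(\<lambda>j. \<rho> j * \<mu> j * poly Q (\<mu> j) + 1 + \<delta> j * \<mu> j ^ m) \<longlonglongrightarrow> 0"
    by (rule tendsto_eventually)
  moreover have "(\<lambda>j. \<rho> j * \<mu> j * poly Q (\<mu> j) + 1 + \<delta> j * \<mu> j ^ m)
      \<longlonglongrightarrow> - (of_nat m * c n * 0 ^ (m - 1)) / U 0 * 0 * poly Q 0 + 1 + c n * 0 ^ m"
    by (intro tendsto_intros \<rho> \<mu>0 \<delta> lim)
  ultimately have "- (of_nat m * c n * 0 ^ (m - 1)) / U 0 * 0 * poly Q 0 + 1 + c n * 0 ^ m = 0"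
    using LIMSEQ_unique by blast
  then show False using m by (simp add: power_0_left)
qed

subsection \<open>Triple roots\<close>

text \<open>Inverse of \<open>gen_poly\<close> on monic polynomials of degree \<open>n\<close>, so
  that curves in coefficient space can be given as deformations of polynomials.\<close>

definition poly_point :: "nat \<Rightarrow> complex poly \<Rightarrow> nat \<Rightarrow> complex" where
  "poly_point n p = (\<lambda>i\<in>{1..n}. coeff p (n - i))"

lemma poly_point_in_cspace: "poly_point n p \<in> cspace {1..n}"
  by (simp add: poly_point_def)

lemma gen_poly_poly_point:
  assumes "degree p = n" "lead_coeff p = 1"
  shows "gen_poly n (poly_point n p) = p"
  using assms by (intro poly_eqI) (auto simp: coeff_gen_poly poly_point_def coeff_eq_0)

lemma poly_point_in_discriminant_set:
  assumes "degree p = n" "lead_coeff p = 1" "p = [:-x, 1:] ^ 2 * q"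
  shows "poly_point n p \<in> discriminant_set n"
proof -
  have "poly p x = 0" "poly (pderiv p) x = 0"
    unfolding assms(3) power2_eq_square mult.assoc
    by (simp_all add: pderiv_mult del: mult_pCons_left mult_pCons_right)
  then show ?thesis
    unfolding mem_discriminant_set gen_poly_poly_point[OF assms(1,2)] using poly_point_in_cspace by blast
qed

text \<open>The bound on the second derivatives, a Cauchy estimate, is uniform, and the two zeros
  \<open>\<plusminus>\<sigma>\<^sub>j\<close> force the derivatives at \<open>\<sigma>\<^sub>j\<close> to tend to zero.\<close>

lemma limit_with_colliding_zeros:
  fixes u :: "nat \<Rightarrow> complex \<Rightarrow> complex" and v :: "complex \<Rightarrow> complex"
  assumes "0 < \<rho>" "\<sigma> \<longlonglongrightarrow> 0"
    and ev: "\<forall>\<^sub>F j in sequentially. u j holomorphic_on ball 0 \<rho> \<and> (\<forall>\<tau>\<in>ball 0 \<rho>. cmod (u j \<tau>) \<le> 1) \<and>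
      \<sigma> j \<noteq> 0 \<and> u j (\<sigma> j) = 0 \<and> u j (- \<sigma> j) = 0"
    and lim: "\<And>\<tau>. \<tau> \<in> ball 0 \<rho> \<Longrightarrow> (\<lambda>j. u j \<tau>) \<longlonglongrightarrow> v \<tau>"
  obtains B where "\<And>\<tau>. \<tau> \<in> ball 0 (\<rho> / 2) \<Longrightarrow> cmod (v \<tau>) \<le> B * cmod \<tau> ^ 2"
proof (rule that)
  \<comment> \<open>Cauchy's bound for the second derivative of a function bounded by 1, on discs of
    radius \<open>\<rho> / 4\<close> centred in the half-size ball.\<close>
  define B where "B = 2 * 1 / (\<rho> / 4) ^ 2"
  fix \<tau> :: complex assume \<tau>: "\<tau> \<in> ball 0 (\<rho> / 2)"
  have "\<forall>\<^sub>F j in sequentially. cmod (\<sigma> j) < \<rho> / 2"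
    using tendstoD[OF assms(2), of "\<rho> / 2"] assms(1) by simp
  with ev have "\<forall>\<^sub>F j in sequentially. cmod (u j \<tau>) \<le> 2 * B * cmod (\<sigma> j) * cmod (\<tau> - \<sigma> j) + B * cmod (\<tau> - \<sigma> j) ^ 2"
  proof eventually_elim
    case (elim j)
    have taylor: "cmod (u j z - (u j w + deriv (u j) w * (z - w))) \<le> B * cmod (z - w) ^ 2"
      if "z \<in> ball 0 (\<rho> / 2)" "w \<in> ball 0 (\<rho> / 2)" for z w
    proof -
      have "cmod ((deriv ^^ 0) (u j) z - (\<Sum>i\<le>1. (deriv ^^ i) (u j) w * (z - w) ^ i / fact i))
          \<le> B * cmod (z - w) ^ Suc 1 / fact 1"
      proof (rule complex_Taylor[where S = "ball 0 (\<rho> / 2)"])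
        fix i and x :: complex assume x: "x \<in> ball 0 (\<rho> / 2)"
        have "(deriv ^^ i) (u j) holomorphic_on ball 0 \<rho>"
          using elim by (intro holomorphic_higher_deriv) auto
        then have "((deriv ^^ i) (u j) has_field_derivative deriv ((deriv ^^ i) (u j)) x) (at x)"
          using x \<open>0 < \<rho>\<close> by (intro holomorphic_derivI[where S = "ball 0 \<rho>"]) auto
        then show "((deriv ^^ i) (u j) has_field_derivative (deriv ^^ Suc i) (u j) x) (at x within ball 0 (\<rho> / 2))"
          by (simp add: has_field_derivative_at_within)
      next
        fix x :: complex assume x: "x \<in> ball 0 (\<rho> / 2)"
        have sub: "cball x (\<rho> / 4) \<subseteq> ball 0 \<rho>"
        proof
          fix y assume "y \<in> cball x (\<rho> / 4)"
          then have "cmod (y - x) \<le> \<rho> / 4" by (simp add: dist_norm norm_minus_commute)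
          then show "y \<in> ball 0 \<rho>" using x \<open>0 < \<rho>\<close> norm_triangle_sub[of y x] by simp
        qed
        have "cmod ((deriv ^^ 2) (u j) x) \<le> fact 2 * 1 / (\<rho> / 4) ^ 2"
        proof (rule Cauchy_inequality)
          show "u j holomorphic_on ball x (\<rho> / 4)"
            using elim sub by (meson ball_subset_cball holomorphic_on_subset order_trans)
          show "continuous_on (cball x (\<rho> / 4)) (u j)"
            using elim sub by (meson holomorphic_on_imp_continuous_on holomorphic_on_subset)
          fix z assume "cmod (x - z) = \<rho> / 4"
          then have "z \<in> cball x (\<rho> / 4)" by (simp add: dist_norm)
          then show "cmod (u j z) \<le> 1" using sub elim by blast
        qed (use \<open>0 < \<rho>\<close> in simp)
        then show "cmod ((deriv ^^ Suc 1) (u j) x) \<le> B" by (simp add: B_def numeral_2_eq_2)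
      qed (use that in auto)
      then show ?thesis by (simp add: numeral_2_eq_2)
    qed
    \<comment> \<open>Expanding at one zero and evaluating at the other leaves only the linear term,
      of size \<open>2 |\<sigma>| |u'(\<sigma>)|\<close>, against a remainder of order
      \<open>|\<sigma>|^2\<close>.\<close>
    have "cmod (- (deriv (u j) (\<sigma> j) * (- \<sigma> j - \<sigma> j))) \<le> B * cmod (- \<sigma> j - \<sigma> j) ^ 2"
      using taylor[of "- \<sigma> j" "\<sigma> j"] elim by simp
    moreover have "- \<sigma> j - \<sigma> j = - (2 * \<sigma> j)" by simp
    ultimately have "cmod (deriv (u j) (\<sigma> j)) * (2 * cmod (\<sigma> j)) \<le> (2 * B * cmod (\<sigma> j)) * (2 * cmod (\<sigma> j))"
      by (simp only: norm_mult norm_minus_cancel) (simp add: power2_eq_square)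
    then have "cmod (deriv (u j) (\<sigma> j)) \<le> 2 * B * cmod (\<sigma> j)"
      using elim by (subst (asm) mult_le_cancel_right_pos) auto
    then have "cmod (deriv (u j) (\<sigma> j) * (\<tau> - \<sigma> j)) \<le> 2 * B * cmod (\<sigma> j) * cmod (\<tau> - \<sigma> j)"
      by (simp add: norm_mult mult_right_mono)
    moreover have "cmod (u j \<tau> - deriv (u j) (\<sigma> j) * (\<tau> - \<sigma> j)) \<le> B * cmod (\<tau> - \<sigma> j) ^ 2"
      using taylor[OF \<tau>, of "\<sigma> j"] elim by simp
    ultimately show ?case
      using norm_triangle_sub[of "u j \<tau>" "deriv (u j) (\<sigma> j) * (\<tau> - \<sigma> j)"] by linarith
  qed
  moreover have "(\<lambda>j. cmod (u j \<tau>)) \<longlonglongrightarrow> cmod (v \<tau>)"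
    using \<tau> \<open>0 < \<rho>\<close> by (intro tendsto_norm lim) auto
  moreover have "(\<lambda>j. 2 * B * cmod (\<sigma> j) * cmod (\<tau> - \<sigma> j) + B * cmod (\<tau> - \<sigma> j) ^ 2)
      \<longlonglongrightarrow> 2 * B * cmod 0 * cmod (\<tau> - 0) + B * cmod (\<tau> - 0) ^ 2"
    by (intro tendsto_intros assms(2))
  ultimately have "cmod (v \<tau>) \<le> 2 * B * cmod 0 * cmod (\<tau> - 0) + B * cmod (\<tau> - 0) ^ 2"
    by (intro tendsto_le[OF sequentially_bot])
  then show "cmod (v \<tau>) \<le> B * cmod \<tau> ^ 2" by simp
qed

section \<open>The cusp of the discriminant set at a triple root\<close>

lemma degree_cube_mult:
  fixes Q :: "complex poly"
  assumes "Q \<noteq> 0"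
  shows "degree ([:-l, 1:] ^ 3 * Q) = degree Q + 3" "lead_coeff ([:-l, 1:] ^ 3 * Q) = lead_coeff Q"
proof -
  have "[:-l, 1:] ^ 3 \<noteq> 0" by (rule power_not_zero) simp
  from degree_mult_eq[OF this assms] show "degree ([:-l, 1:] ^ 3 * Q) = degree Q + 3"
    unfolding degree_linear_power by simp
  show "lead_coeff ([:-l, 1:] ^ 3 * Q) = lead_coeff Q"
    unfolding lead_coeff_mult lead_coeff_power by simp
qed

text \<open>The nesting displays the scale \<open>s^2\<close>, the limiting direction
  \<open>-3 y Q\<close> and the vanishing correction \<open>2 s Q\<close>.\<close>

lemma cubic_split:
  fixes Q :: "complex poly"
  shows "[:-l, 1:] ^ 3 * Q + Polynomial.smult (s\<^sup>2) (Polynomial.smult (-3) ([:-l, 1:] * Q) + Polynomial.smult s (Polynomial.smult 2 Q))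
    = [:-(l + s), 1:] ^ 2 * ([:-l + 2 * s, 1:] * Q)"
  by (subst poly_eq_poly_eq_iff[symmetric])
    (simp add: fun_eq_iff algebra_simps power2_eq_square power3_eq_cube)

lemma tendsto_inverse_Suc: "(\<lambda>j. 1 / of_nat (Suc j) :: complex) \<longlonglongrightarrow> 0"
  using LIMSEQ_Suc[OF lim_1_over_n[where 'a = complex]] by (simp del: of_nat_Suc)

text \<open>The gradient annihilates \<open>y\<^sup>2 S\<close> (\<open>y = x - l\<close>) because \<open>y\<^sup>3 Q + t y\<^sup>2 S\<close> has the double root
  \<open>l\<close>, and \<open>y Q\<close> because \<open>(y - s)\<^sup>2 (y + 2 s) Q\<close> equals \<open>(y\<^sup>3 - 3 s\<^sup>2 y + 2 s\<^sup>3) Q\<close>. It annihilates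
  \<open>Q\<close> because the line \<open>(y\<^sup>3 - 3 s\<^sup>2 y + \<tau>) Q\<close> meets the discriminant set at \<open>\<tau> = \<plusminus>2 s\<^sup>3\<close>,
  and these two zeros of \<open>h\<close> collide as \<open>s \<rightarrow> 0\<close>.\<close>

lemma gradient_zero_at_triple_root:
  fixes Q :: "complex poly" and l :: complex
  defines "y \<equiv> [:-l, 1:]"
  assumes Q: "degree Q + 3 = n" "lead_coeff Q = 1" "poly Q l \<noteq> 0"
    and A: "A = poly_point n (y ^ 3 * Q)" "A \<in> U"
    and hol: "holomorphic_in {1..n} h U" and zero: "\<And>a. a \<in> discriminant_set n \<Longrightarrow> a \<in> U \<Longrightarrow> h a = 0"
    and grad: "has_gradient {1..n} h U A c"
  shows "(\<Sum>i=1..n. c i * v i) = 0"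
proof -
  define P where "P = y ^ 3 * Q"
  have y: "degree y = 1" "lead_coeff y = 1" "y \<noteq> 0" by (simp_all add: y_def)
  have Q0: "Q \<noteq> 0" using Q(3) by auto
  have degP: "degree P = n" "lead_coeff P = 1"
    using degree_cube_mult[OF Q0, of l] Q by (simp_all add: P_def y_def)
  have degs: "degree Q < n" "degree (y * Q) < n"
    using Q y Q0 by (simp_all add: degree_mult_eq)
  have monic: "degree (P + q) = n" "lead_coeff (P + q) = 1" if "degree q < n" for q
  proof -
    show "degree (P + q) = n" using that degP(1) by (simp add: degree_add_eq_left)
    then show "lead_coeff (P + q) = 1" using that degP by (simp add: coeff_eq_0)
  qed
  have P_sq: "P = [:-l, 1:] ^ 2 * (y * Q)"
    by (simp only: P_def y_def power2_eq_square power3_eq_cube mult.assoc)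
  then have A_D: "A \<in> discriminant_set n"
    unfolding A P_def[symmetric] by (rule poly_point_in_discriminant_set[OF degP])
  \<comment> \<open>The gradient as a linear functional on polynomials, since \<open>a_i\<close> is
    the coefficient of \<open>x^(n-i)\<close>.\<close>
  define L where "L q = (\<Sum>i=1..n. c i * coeff q (n - i))" for q
  have L_add: "L (p + q) = L p + L q" and L_smult: "L (Polynomial.smult t q) = t * L q" for p q t
    by (simp_all add: L_def distrib_left sum.distrib sum_distrib_left mult_ac)
  have U: "openin (ctop {1..n}) U" using hol by (simp add: holomorphic_in_def)
  obtain e where e: "0 < e"
    "\<And>z. z \<in> cspace {1..n} \<Longrightarrow> (\<And>i. i \<in> {1..n} \<Longrightarrow> cmod (z i - A i) < e) \<Longrightarrow> z \<in> U"
    using openin_ctop_contains_box[OF _ U A(2)] by blast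
  have Ai: "A i = coeff P (n - i)" if "i \<in> {1..n}" for i using that by (simp add: A P_def poly_point_def)

  \<comment> \<open>Along polynomials with a double root \<open>h\<close> is zero, so its difference
    quotients in the scale \<open>\<sigma>\<close> vanish, while they converge to \<open>L\<close>
    of the limiting direction \<open>q\<close>.\<close>
  have tangent: "L q = 0"
    if \<sigma>: "\<sigma> \<longlonglongrightarrow> 0" "\<And>j. \<sigma> j \<noteq> 0" and s: "s \<longlonglongrightarrow> 0" and deg: "degree q < n" "degree q' < n"
      and dbl: "\<And>j. P + Polynomial.smult (\<sigma> j) (q + Polynomial.smult (s j) q') = [:- x j, 1:] ^ 2 * R j"
    for \<sigma> s :: "nat \<Rightarrow> complex" and q q' x R
  proof -
    define \<gamma> where "\<gamma> j = poly_point n (P + Polynomial.smult (\<sigma> j) (q + Polynomial.smult (s j) q'))" for j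
    have diff: "\<gamma> j i - A i = \<sigma> j * (coeff q (n - i) + s j * coeff q' (n - i))" if "i \<in> {1..n}" for i j
      using that by (simp add: \<gamma>_def poly_point_def Ai)
    have "(\<lambda>j. \<gamma> j i - A i) \<longlonglongrightarrow> 0" if "i \<in> {1..n}" for i
      unfolding diff[OF that] by (auto intro!: tendsto_eq_intros \<sigma> s)
    then have "\<forall>\<^sub>F j in sequentially. \<forall>i\<in>{1..n}. cmod (\<gamma> j i - A i) < e"
      using e(1) by (intro eventually_ball_finite) (auto simp: tendsto_iff dist_norm)
    then have \<gamma>U: "\<forall>\<^sub>F j in sequentially. \<gamma> j \<in> U"
    proof eventually_elim
      case (elim j)
      have "\<gamma> j \<in> cspace {1..n}" unfolding \<gamma>_def by (rule poly_point_in_cspace)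
      then show ?case by (rule e(2)) (use elim in blast)
    qed
    have "(\<lambda>j. (h (\<gamma> j) - h A) / \<sigma> j) \<longlonglongrightarrow> (\<Sum>i=1..n. c i * coeff q (n - i))"
    proof (rule has_gradient_along[OF grad _ \<gamma>U \<sigma>(1)])
      fix i assume i: "i \<in> {1..n}"
      have "(\<lambda>j. coeff q (n - i) + s j * coeff q' (n - i)) \<longlonglongrightarrow> coeff q (n - i)"
        by (auto intro!: tendsto_eq_intros s)
      then show "(\<lambda>j. (\<gamma> j i - A i) / \<sigma> j) \<longlonglongrightarrow> coeff q (n - i)"
        using \<sigma>(2) by (simp add: diff[OF i])
    qed (use \<sigma> in auto)
    moreover have "\<forall>\<^sub>F j in sequentially. (h (\<gamma> j) - h A) / \<sigma> j = 0"
      using \<gamma>U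
    proof eventually_elim
      case (elim j)
      have "degree (Polynomial.smult (\<sigma> j) (q + Polynomial.smult (s j) q')) < n"
        using deg by (meson degree_add_less degree_smult_le le_less_trans)
      from poly_point_in_discriminant_set[OF monic[OF this] dbl]
      have "\<gamma> j \<in> discriminant_set n" by (simp add: \<gamma>_def)
      moreover note A_D
      ultimately show ?case using zero elim A(2) by simp
    qed
    then have "(\<lambda>j. (h (\<gamma> j) - h A) / \<sigma> j) \<longlonglongrightarrow> 0"
      by (rule tendsto_eventually)
    ultimately show ?thesis
      unfolding L_def by (rule LIMSEQ_unique)
  qed

  define t where "t j = (1 / of_nat (Suc j) :: complex)" for j
  have t: "t \<longlonglongrightarrow> 0" "\<And>j. t j \<noteq> 0" using tendsto_inverse_Suc unfolding t_def by (simp_all del: of_nat_Suc)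
  have t2: "(\<lambda>j. (t j)\<^sup>2) \<longlonglongrightarrow> 0" using tendsto_power[OF t(1), of 2] by simp
  have t3: "(\<lambda>j. 2 * t j ^ 3) \<longlonglongrightarrow> 0" by (auto intro!: tendsto_eq_intros t)

  have L_square: "L (y ^ 2 * S) = 0" if "degree (y ^ 2 * S) < n" for S
  proof (rule tangent[OF t tendsto_const that])
    show "degree 0 < n" using degs by simp
    show "P + Polynomial.smult (t j) (y ^ 2 * S + Polynomial.smult 0 0) = [:-l, 1:] ^ 2 * (y * Q + Polynomial.smult (t j) S)" for j
      by (simp only: P_sq y_def distrib_left mult_smult_right smult_0_right add_0_right)
  qed

  have "L (Polynomial.smult (-3) (y * Q)) = 0"
  proof (rule tangent[OF t2 _ t(1)])
    show "degree (Polynomial.smult (-3) (y * Q)) < n" "degree (Polynomial.smult 2 Q) < n"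
      using degs by simp_all
    show "P + Polynomial.smult ((t j)\<^sup>2) (Polynomial.smult (-3) (y * Q) + Polynomial.smult (t j) (Polynomial.smult 2 Q))
        = [:-(l + t j), 1:] ^ 2 * ([:-l + 2 * t j, 1:] * Q)" for j
      unfolding P_def y_def by (rule cubic_split)
  qed (use t in simp)
  then have L_yQ: "L (y * Q) = 0" by (simp only: L_smult) simp

  \<comment> \<open>Along the cusp \<open>Q\<close> enters with \<open>s^3\<close>, below the scale
    \<open>s^2\<close> of \<open>y Q\<close>, so \<open>tangent\<close> gives nothing here.\<close>
  have L_Q: "L Q = 0"
  proof -
    define p where "p s \<tau> = P + (Polynomial.smult (s\<^sup>2) (Polynomial.smult (-3) (y * Q)) + Polynomial.smult \<tau> Q)" for s \<tau>
    define \<gamma> where "\<gamma> s \<tau> = poly_point n (p s \<tau>)" for s \<tau>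
    have \<gamma>: "\<gamma> s \<tau> i = A i + (-3) * s\<^sup>2 * coeff (y * Q) (n - i) + \<tau> * coeff Q (n - i)"
      if "i \<in> {1..n}" for s \<tau> i
      using that by (simp add: \<gamma>_def p_def poly_point_def Ai)
    have hA: "h A = 0" using A_D A zero by blast
    \<comment> \<open>Continuity of \<open>h\<close> at \<open>A\<close> provides the bound 1 for
      the Cauchy estimate, uniformly in \<open>s\<close>.\<close>
    obtain d where d: "0 < d"
      "\<And>z. z \<in> U \<Longrightarrow> (\<And>i. i \<in> {1..n} \<Longrightarrow> cmod (z i - A i) < d) \<Longrightarrow> cmod (h z - h A) < 1"
      apply (rule has_gradient_continuous[OF grad finite_atLeastAtMost less_numeral_extra(1)])
      subgoal premises p for d by (rule p(1)[of d, OF p(2-)])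
      done
    define K where "K = 1 + (\<Sum>i=1..n. 3 * cmod (coeff (y * Q) (n - i)) + cmod (coeff Q (n - i)))"
    have K: "0 < K" unfolding K_def by (intro add_pos_nonneg sum_nonneg) auto
    define \<rho> where "\<rho> = min e d / (2 * K)"
    have \<rho>: "0 < \<rho>" "\<rho> * K < min e d" using e d K by (auto simp: \<rho>_def)
    have near: "cmod (\<gamma> s \<tau> i - A i) < min e d"
      if "cmod (s\<^sup>2) < \<rho>" "cmod \<tau> < \<rho>" "i \<in> {1..n}" for s \<tau> i
    proof -
      have "cmod (\<gamma> s \<tau> i - A i) \<le> cmod ((-3) * s\<^sup>2 * coeff (y * Q) (n - i)) + cmod (\<tau> * coeff Q (n - i))"
        unfolding \<gamma>[OF that(3)] by (metis add.assoc add_diff_cancel_left' norm_triangle_ineq)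
      also have "\<dots> = cmod (s\<^sup>2) * (3 * cmod (coeff (y * Q) (n - i))) + cmod \<tau> * cmod (coeff Q (n - i))"
        by (simp add: norm_mult)
      also have "\<dots> \<le> \<rho> * (3 * cmod (coeff (y * Q) (n - i))) + \<rho> * cmod (coeff Q (n - i))"
        using that by (intro add_mono mult_right_mono) auto
      also have "\<dots> = \<rho> * (3 * cmod (coeff (y * Q) (n - i)) + cmod (coeff Q (n - i)))"
        by (simp add: distrib_left)
      also have "\<dots> \<le> \<rho> * K"
      proof -
        have "3 * cmod (coeff (y * Q) (n - i)) + cmod (coeff Q (n - i))
            \<le> (\<Sum>i=1..n. 3 * cmod (coeff (y * Q) (n - i)) + cmod (coeff Q (n - i)))"
          using that(3) by (intro member_le_sum[where f = "\<lambda>i. 3 * cmod (coeff (y * Q) (n - i)) + cmod (coeff Q (n - i))"]) auto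
        then show ?thesis using \<rho>(1) by (intro mult_left_mono) (simp_all add: K_def)
      qed
      also have "\<dots> < min e d" by fact
      finally show ?thesis .
    qed
    have \<gamma>U: "\<gamma> s \<tau> \<in> U" if "cmod (s\<^sup>2) < \<rho>" "cmod \<tau> < \<rho>" for s \<tau>
    proof (rule e(2))
      show "\<gamma> s \<tau> \<in> cspace {1..n}" unfolding \<gamma>_def by (rule poly_point_in_cspace)
    qed (use near[OF that] in simp)
    have bnd: "cmod (h (\<gamma> s \<tau>)) \<le> 1" if "cmod (s\<^sup>2) < \<rho>" "cmod \<tau> < \<rho>" for s \<tau>
      using d(2)[OF \<gamma>U[OF that]] near[OF that] hA by (simp add: less_imp_le)
    have "(\<lambda>\<tau>. h (\<gamma> s \<tau>)) holomorphic_on ball 0 \<rho>" if s: "cmod (s\<^sup>2) < \<rho>" for s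
      unfolding holomorphic_on_open[OF open_ball]
    proof
      fix \<tau>0 assume \<tau>0: "\<tau>0 \<in> ball (0 :: complex) \<rho>"
      then have "\<gamma> s \<tau>0 \<in> U" using \<gamma>U s by simp
      then obtain c' where c': "has_gradient {1..n} h U (\<gamma> s \<tau>0) c'"
        using hol unfolding holomorphic_in_iff_gradient by blast
      have "\<forall>\<^sub>F \<tau> in at \<tau>0. \<tau> \<in> ball 0 \<rho>" using \<tau>0 by (intro eventually_at_in_open') auto
      then have ev: "\<forall>\<^sub>F \<tau> in at \<tau>0. \<gamma> s \<tau> \<in> U"
        by eventually_elim (use \<gamma>U s in simp)
      have ne: "\<forall>\<^sub>F \<tau> in at \<tau>0. \<tau> - \<tau>0 \<noteq> 0"
        using eventually_neq_at_within[of \<tau>0 \<tau>0 UNIV] by eventually_elim simp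
      have "((\<lambda>\<tau>. (h (\<gamma> s \<tau>) - h (\<gamma> s \<tau>0)) / (\<tau> - \<tau>0)) \<longlongrightarrow> (\<Sum>i=1..n. c' i * coeff Q (n - i))) (at \<tau>0)"
      proof (rule has_gradient_along[OF c' _ ev _ ne])
        show "((\<lambda>\<tau>. \<tau> - \<tau>0) \<longlongrightarrow> 0) (at \<tau>0)" by (auto intro!: tendsto_eq_intros)
        fix i assume i: "i \<in> {1..n}"
        have "\<forall>\<^sub>F \<tau> in at \<tau>0. coeff Q (n - i) = (\<gamma> s \<tau> i - \<gamma> s \<tau>0 i) / (\<tau> - \<tau>0)"
          using ne by eventually_elim (simp add: \<gamma>[OF i] left_diff_distrib[symmetric])
        then show "((\<lambda>\<tau>. (\<gamma> s \<tau> i - \<gamma> s \<tau>0 i) / (\<tau> - \<tau>0)) \<longlongrightarrow> coeff Q (n - i)) (at \<tau>0)"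
          by (rule Lim_transform_eventually[OF tendsto_const])
      qed auto
      then show "\<exists>f'. ((\<lambda>\<tau>. h (\<gamma> s \<tau>)) has_field_derivative f') (at \<tau>0)"
        by (auto simp: has_field_derivative_iff)
    qed
    note hol_line = this
    have cube: "\<gamma> s (2 * s ^ 3) \<in> discriminant_set n" for s
    proof -
      have deg: "degree (Polynomial.smult (s\<^sup>2) (Polynomial.smult (-3) (y * Q)) + Polynomial.smult (2 * s ^ 3) Q) < n"
        using degs by (intro degree_add_less) (auto intro: le_less_trans[OF degree_smult_le])
      have "p s (2 * s ^ 3) = P + Polynomial.smult (s\<^sup>2) (Polynomial.smult (-3) (y * Q) + Polynomial.smult s (Polynomial.smult 2 Q))"
        by (simp add: p_def smult_add_right smult_diff_right power2_eq_square power3_eq_cube mult_ac)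
      then have "p s (2 * s ^ 3) = [:-(l + s), 1:] ^ 2 * ([:-l + 2 * s, 1:] * Q)"
        unfolding P_def y_def cubic_split .
      moreover have "degree (p s (2 * s ^ 3)) = n" "lead_coeff (p s (2 * s ^ 3)) = 1"
        unfolding p_def by (rule monic[OF deg])+
      ultimately show ?thesis
        unfolding \<gamma>_def by (intro poly_point_in_discriminant_set)
    qed
    \<comment> \<open>Replacing \<open>s\<close> by \<open>-s\<close> keeps \<open>s^2\<close> and
      reverses \<open>2 s^3\<close>: both branches of the cusp lie on one line.\<close>
    have cube': "\<gamma> s (- (2 * s ^ 3)) \<in> discriminant_set n" for s
      using cube[of "- s"] by (simp add: \<gamma>_def p_def)
    have t2_small: "\<forall>\<^sub>F j in sequentially. cmod ((t j)\<^sup>2) < \<rho>" and "\<forall>\<^sub>F j in sequentially. cmod (2 * t j ^ 3) < \<rho>"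
      using t2 t3 \<rho>(1) unfolding tendsto_iff dist_norm diff_zero by blast+
    with t2_small have ev: "\<forall>\<^sub>F j in sequentially. (\<lambda>\<tau>. h (\<gamma> (t j) \<tau>)) holomorphic_on ball 0 \<rho> \<and>
      (\<forall>\<tau>\<in>ball 0 \<rho>. cmod (h (\<gamma> (t j) \<tau>)) \<le> 1) \<and>
      2 * t j ^ 3 \<noteq> 0 \<and> h (\<gamma> (t j) (2 * t j ^ 3)) = 0 \<and> h (\<gamma> (t j) (- (2 * t j ^ 3))) = 0"
    proof eventually_elim
      case (elim j)
      have "h (\<gamma> (t j) (2 * t j ^ 3)) = 0" using elim by (intro zero cube \<gamma>U)
      moreover have "h (\<gamma> (t j) (- (2 * t j ^ 3))) = 0"
        using elim by (intro zero cube' \<gamma>U) (simp_all only: norm_minus_cancel)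
      ultimately show ?case using hol_line[OF elim(1)] bnd[OF elim(1)] t(2)[of j] by simp
    qed
    have lim: "(\<lambda>j. h (\<gamma> (t j) \<tau>)) \<longlonglongrightarrow> h (\<gamma> 0 \<tau>)" if \<tau>: "\<tau> \<in> ball 0 \<rho>" for \<tau>
    proof -
      have "\<gamma> 0 \<tau> \<in> U" using \<gamma>U[of 0 \<tau>] \<tau> \<rho>(1) by simp
      then obtain c' where c': "has_gradient {1..n} h U (\<gamma> 0 \<tau>) c'"
        using hol unfolding holomorphic_in_iff_gradient by blast
      have "\<forall>\<^sub>F j in sequentially. \<gamma> (t j) \<tau> \<in> U"
        using t2_small by eventually_elim (use \<tau> in \<open>intro \<gamma>U, simp_all\<close>)
      then show ?thesis
      proof (rule has_gradient_tendsto[OF c' finite_atLeastAtMost])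
        fix i assume i: "i \<in> {1..n}"
        show "(\<lambda>j. \<gamma> (t j) \<tau> i) \<longlonglongrightarrow> \<gamma> 0 \<tau> i"
          unfolding \<gamma>[OF i] by (auto intro!: tendsto_eq_intros t(1))
      qed
    qed
    \<comment> \<open>On the limiting line through \<open>A\<close> the function \<open>h\<close> is
      quadratically small, so its derivative there, which is \<open>L Q\<close>, vanishes.\<close>
    obtain B where B: "\<And>\<tau>. \<tau> \<in> ball 0 (\<rho> / 2) \<Longrightarrow> cmod (h (\<gamma> 0 \<tau>)) \<le> B * cmod \<tau> ^ 2"
      using limit_with_colliding_zeros[OF \<rho>(1) t3 ev lim] by blast
    have t_small: "\<forall>\<^sub>F j in sequentially. cmod (t j) < \<rho> / 2"
      using tendstoD[OF t(1), of "\<rho> / 2"] \<rho>(1) by simp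
    then have U_ev: "\<forall>\<^sub>F j in sequentially. \<gamma> 0 (t j) \<in> U"
      by eventually_elim (use \<gamma>U[of 0] \<rho>(1) in auto)
    have "(\<lambda>j. (h (\<gamma> 0 (t j)) - h A) / t j) \<longlonglongrightarrow> (\<Sum>i=1..n. c i * coeff Q (n - i))"
      by (rule has_gradient_along[OF grad _ U_ev t(1)]) (use t(2) in \<open>auto simp: \<gamma>\<close>)
    moreover have "(\<lambda>j. (h (\<gamma> 0 (t j)) - h A) / t j) \<longlonglongrightarrow> 0"
    proof (rule Lim_null_comparison)
      show "\<forall>\<^sub>F j in sequentially. cmod ((h (\<gamma> 0 (t j)) - h A) / t j) \<le> B * cmod (t j)"
        using t_small
      proof eventually_elim
        case (elim j)
        then show ?case using B[of "t j"] t(2)[of j]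
          by (simp add: hA norm_divide divide_le_eq power2_eq_square mult.assoc)
      qed
      show "(\<lambda>j. B * cmod (t j)) \<longlonglongrightarrow> 0"
        by (intro tendsto_mult_right_zero tendsto_norm_zero t(1))
    qed
    ultimately show ?thesis unfolding L_def by (rule LIMSEQ_unique)
  qed

  define q where "q = gen_poly n v - monom 1 n"
  have q: "coeff q j = (if j < n then v (n - j) else 0)" for j
    by (simp add: q_def coeff_gen_poly)
  have deg_q: "degree q < n" using Q(1) by (intro degree_lessI) (auto simp: q)
  \<comment> \<open>Two divisions by \<open>y\<close>, each after matching the value at
    \<open>l\<close> by a multiple of \<open>Q\<close>, give
    \<open>q = \<alpha> Q + \<beta> y Q + y^2 S\<close>. Both use that \<open>Q\<close> is nonzero
    at \<open>l\<close>.\<close>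
  define \<alpha> where "\<alpha> = poly q l / poly Q l"
  have "poly (q - Polynomial.smult \<alpha> Q) l = 0" using Q(3) by (simp add: \<alpha>_def)
  then obtain q2 where q2: "q - Polynomial.smult \<alpha> Q = y * q2"
    unfolding poly_eq_0_iff_dvd y_def by (elim dvdE)
  define \<beta> where "\<beta> = poly q2 l / poly Q l"
  have "poly (q2 - Polynomial.smult \<beta> Q) l = 0" using Q(3) by (simp add: \<beta>_def)
  then obtain S where S: "q2 - Polynomial.smult \<beta> Q = y * S"
    unfolding poly_eq_0_iff_dvd y_def by (elim dvdE)
  have "y * q2 = y * (y * S + Polynomial.smult \<beta> Q)" by (simp flip: S)
  then have y2S: "y ^ 2 * S = q - Polynomial.smult \<alpha> Q - Polynomial.smult \<beta> (y * Q)"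
    by (simp add: q2 power2_eq_square algebra_simps)
  have "degree (y ^ 2 * S) < n"
    unfolding y2S using degs deg_q
    by (intro degree_diff_less) (auto intro: le_less_trans[OF degree_smult_le])
  from L_square[OF this] have "L (y ^ 2 * S + (Polynomial.smult \<alpha> Q + Polynomial.smult \<beta> (y * Q))) = 0"
    by (simp only: L_add L_smult L_Q L_yQ mult_zero_right add_0_right)
  then have "L q = 0" by (simp add: y2S)
  moreover have "L q = (\<Sum>i=1..n. c i * v i)"
    unfolding L_def by (intro sum.cong) (auto simp: q)
  ultimately show ?thesis by simp
qed

text \<open>A nearby point of the discriminant set has a root of multiplicity exactly three, and
  smoothness at \<open>A\<close> provides a chart around that point as well.\<close>

lemma not_smooth_at_triple_root:
  assumes A: "A \<in> cspace {1..n}" and ord: "3 \<le> order l (gen_poly n A)"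
  shows "\<not> smooth_hypersurface_at n (discriminant_set n) A"
proof
  define y where "y = [:-l, 1:]"
  assume "smooth_hypersurface_at n (discriminant_set n) A"
  then obtain N where N: "openin (ctop {1..n}) N" "A \<in> N"
    and sub: "complex_submanifold n (n - 1) (discriminant_set n \<inter> N)"
    by (auto simp: smooth_hypersurface_at_def)
  obtain e where e: "0 < e"
    "\<And>z. z \<in> cspace {1..n} \<Longrightarrow> (\<And>i. i \<in> {1..n} \<Longrightarrow> cmod (z i - A i) < e) \<Longrightarrow> z \<in> N"
    using openin_ctop_contains_box[OF _ N] by blast
  have "y ^ 3 dvd gen_poly n A" using ord unfolding y_def order_divides by simp
  then obtain Q1 where Q1: "gen_poly n A = y ^ 3 * Q1" by (elim dvdE)
  have Q1_0: "Q1 \<noteq> 0" using Q1 gen_poly_nonzero[of n A] by auto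
  have Q1_monic: "degree Q1 + 3 = n" "lead_coeff Q1 = 1"
    using degree_cube_mult[OF Q1_0, of l] lead_coeff_gen_poly[of n A] unfolding y_def[symmetric] Q1[symmetric]
    by simp_all
  \<comment> \<open>If \<open>Q1\<close> vanishes at \<open>l\<close>, a small constant is added to
    it; \<open>Q1\<close> is then nonconstant, so its degree and leading coefficient
    survive.\<close>
  obtain \<epsilon> where \<epsilon>: "degree (Q1 + [:\<epsilon>:]) + 3 = n" "lead_coeff (Q1 + [:\<epsilon>:]) = 1" "poly (Q1 + [:\<epsilon>:]) l \<noteq> 0"
    "\<And>i. i \<in> {1..n} \<Longrightarrow> cmod (\<epsilon> * coeff (y ^ 3) (n - i)) < e"
  proof (cases "poly Q1 l = 0")
    case False
    then show thesis using that[of 0] Q1_monic e(1) by simp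
  next
    case True
    have deg: "0 < degree Q1"
    proof (rule ccontr)
      assume "\<not> 0 < degree Q1"
      then obtain b where "Q1 = [:b:]" by (metis degree_eq_zeroE neq0_conv)
      with True Q1_0 show False by simp
    qed
    have "\<forall>\<^sub>F \<epsilon> in at 0. \<forall>i\<in>{1..n}. cmod (\<epsilon> * coeff (y ^ 3) (n - i)) < e"
    proof (intro eventually_ball_finite ballI)
      fix i
      have "((\<lambda>\<epsilon>. \<epsilon> * coeff (y ^ 3) (n - i)) \<longlongrightarrow> 0) (at 0)" by (auto intro!: tendsto_eq_intros)
      then show "\<forall>\<^sub>F \<epsilon> in at 0. cmod (\<epsilon> * coeff (y ^ 3) (n - i)) < e"
        using e(1) unfolding tendsto_iff dist_norm diff_zero by blast
    qed simp
    then have "\<forall>\<^sub>F \<epsilon> in at 0. \<epsilon> \<noteq> 0 \<and> (\<forall>i\<in>{1..n}. cmod (\<epsilon> * coeff (y ^ 3) (n - i)) < e)"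
      using eventually_neq_at_within[of 0 0 UNIV] by eventually_elim simp
    then obtain \<epsilon> :: complex where \<epsilon>: "\<epsilon> \<noteq> 0" "\<forall>i\<in>{1..n}. cmod (\<epsilon> * coeff (y ^ 3) (n - i)) < e"
      using eventually_happens'[OF at_neq_bot] by blast
    have d: "degree (Q1 + [:\<epsilon>:]) = degree Q1" using deg by (intro degree_add_eq_left) simp
    moreover have "coeff (Q1 + [:\<epsilon>:]) (degree Q1) = 1"
      using Q1_monic deg by (simp add: coeff_pCons split: nat.split)
    ultimately show thesis using that[of \<epsilon>] Q1_monic True \<epsilon> by simp
  qed
  define Q where "Q = Q1 + [:\<epsilon>:]"
  note Q = \<epsilon>(1-3)[folded Q_def]
  define A' where "A' = poly_point n (y ^ 3 * Q)"
  have A'_ext: "A' \<in> cspace {1..n}" unfolding A'_def by (rule poly_point_in_cspace)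
  have A'_diff: "A' i - A i = \<epsilon> * coeff (y ^ 3) (n - i)" if "i \<in> {1..n}" for i
  proof -
    have "y ^ 3 * Q = gen_poly n A + Polynomial.smult \<epsilon> (y ^ 3)"
      by (simp add: Q_def Q1 distrib_left)
    then show ?thesis using that by (auto simp: A'_def poly_point_def coeff_gen_poly)
  qed
  have A'N: "A' \<in> N" by (rule e(2)[OF A'_ext]) (use \<epsilon>(4) A'_diff in simp)
  have Q0: "Q \<noteq> 0" using Q(3) by auto
  have "y ^ 3 * Q = [:-l, 1:] ^ 2 * (y * Q)"
    by (simp only: y_def power3_eq_cube power2_eq_square mult.assoc)
  then have "A' \<in> discriminant_set n"
    unfolding A'_def using degree_cube_mult[OF Q0, of l] Q
    by (intro poly_point_in_discriminant_set) (auto simp: y_def)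
  with A'N have "A' \<in> discriminant_set n \<inter> N" by (rule IntI[rotated])
  with sub have "\<exists>U V \<phi>. A' \<in> U \<and> biholomorphic {1..n} \<phi> U V \<and>
      \<phi> ` (discriminant_set n \<inter> N \<inter> U) = {z \<in> V. \<forall>i\<in>{n - 1<..n}. z i = 0}"
    unfolding complex_submanifold_def by (elim conjE) (drule (1) bspec)
  then obtain U V \<phi> where A'U: "A' \<in> U" and bih: "biholomorphic {1..n} \<phi> U V"
    and im: "\<phi> ` (discriminant_set n \<inter> N \<inter> U) = {z \<in> V. \<forall>i\<in>{n - 1<..n}. z i = 0}"
    by (elim exE conjE)
  have n: "n \<in> {1..n}" using Q(1) by simp
  have bij: "bij_betw \<phi> U V" and hol: "holomorphic_in {1..n} (\<lambda>z. \<phi> z n) U"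
    and hol': "\<And>i. i \<in> {1..n} \<Longrightarrow> holomorphic_in {1..n} (\<lambda>z. inv_into U \<phi> z i) V"
    and V: "openin (ctop {1..n}) V"
    using bih n by (auto simp: biholomorphic_def)
  obtain c where c: "has_gradient {1..n} (\<lambda>z. \<phi> z n) U A' c"
    using hol A'U unfolding holomorphic_in_iff_gradient by blast
  have hol_sub: "holomorphic_in {1..n} (\<lambda>z. \<phi> z n) (U \<inter> N)"
    using hol N(1) has_gradient_subset[of _ _ U _ _ "U \<inter> N"] unfolding holomorphic_in_iff_gradient
    by (meson IntD1 inf_le1 openin_Int)
  have zero: "(\<Sum>i=1..n. c i * v i) = 0" for v
  proof (rule gradient_zero_at_triple_root[OF Q, folded y_def, OF A'_def _ hol_sub])
    show "A' \<in> U \<inter> N" using A'U A'N by simp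
    show "has_gradient {1..n} (\<lambda>z. \<phi> z n) (U \<inter> N) A' c" by (rule has_gradient_subset[OF c]) simp
    fix a assume "a \<in> discriminant_set n" "a \<in> U \<inter> N"
    then have "\<phi> a \<in> \<phi> ` (discriminant_set n \<inter> N \<inter> U)" by blast
    then show "\<phi> a n = 0" unfolding im using n by auto
  qed

  define \<psi> where "\<psi> = inv_into U \<phi>"
  define b where "b = \<phi> A'"
  have b: "b \<in> V" "\<psi> b = A'"
    using bij A'U by (auto simp: b_def \<psi>_def bij_betw_def)
  have \<psi>: "\<psi> z \<in> U" "\<phi> (\<psi> z) = z" if "z \<in> V" for z
    using bij that by (auto simp: \<psi>_def bij_betw_def inv_into_into f_inv_into_f)
  define t where "t j = (1 / of_nat (Suc j) :: complex)" for j
  have t: "t \<longlonglongrightarrow> 0" "\<And>j. t j \<noteq> 0" using tendsto_inverse_Suc unfolding t_def by (simp_all del: of_nat_Suc)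
  \<comment> \<open>The last chart coordinate is moved by \<open>t j\<close> and pulled back by
    \<open>\<psi>\<close>. The resulting points approach \<open>A'\<close> with a limiting velocity
    \<open>v\<close>, and the gradient applied to \<open>v\<close> must be 1.\<close>
  define z where "z j = b(n := b n + t j)" for j
  have b_ext: "b \<in> cspace {1..n}" using b(1) V openin_ctop_subset by blast
  obtain e' where e': "0 < e'"
    "\<And>z. z \<in> cspace {1..n} \<Longrightarrow> (\<And>i. i \<in> {1..n} \<Longrightarrow> cmod (z i - b i) < e') \<Longrightarrow> z \<in> V"
    using openin_ctop_contains_box[OF _ V b(1)] by blast
  have "\<forall>\<^sub>F j in sequentially. cmod (t j) < e'"
    using t(1) e'(1) unfolding tendsto_iff dist_norm diff_zero by blast
  then have zV: "\<forall>\<^sub>F j in sequentially. z j \<in> V"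
  proof eventually_elim
    case (elim j)
    show ?case
      by (rule e'(2)) (use b_ext n elim e'(1) in \<open>auto simp: z_def PiE_iff extensional_def\<close>)
  qed
  have "\<exists>g. (\<lambda>j. (\<psi> (z j) i - \<psi> b i) / t j) \<longlonglongrightarrow> g" if i: "i \<in> {1..n}" for i
  proof -
    obtain g where g: "has_gradient {1..n} (\<lambda>z. \<psi> z i) V b g"
      using hol'[OF i] b(1) unfolding holomorphic_in_iff_gradient \<psi>_def by blast
    have "(\<lambda>j. (\<psi> (z j) i - \<psi> b i) / t j) \<longlonglongrightarrow> (\<Sum>k=1..n. g k * (if k = n then 1 else 0))"
      by (rule has_gradient_along[OF g _ zV t(1)]) (use t(2) in \<open>auto simp: z_def\<close>)
    then show ?thesis by blast
  qed
  then obtain v where v: "\<And>i. i \<in> {1..n} \<Longrightarrow> (\<lambda>j. (\<psi> (z j) i - A' i) / t j) \<longlonglongrightarrow> v i"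
    unfolding b(2) by metis
  have "\<forall>\<^sub>F j in sequentially. \<psi> (z j) \<in> U" using zV by eventually_elim (rule \<psi>)
  then have "(\<lambda>j. (\<phi> (\<psi> (z j)) n - \<phi> A' n) / t j) \<longlonglongrightarrow> (\<Sum>i=1..n. c i * v i)"
    by (rule has_gradient_along[OF c finite_atLeastAtMost _ t(1)]) (use t(2) v in auto)
  moreover have "\<forall>\<^sub>F j in sequentially. 1 = (\<phi> (\<psi> (z j)) n - \<phi> A' n) / t j"
    using zV by eventually_elim (use t(2) in \<open>simp add: \<psi> z_def b_def\<close>)
  then have "(\<lambda>j. (\<phi> (\<psi> (z j)) n - \<phi> A' n) / t j) \<longlonglongrightarrow> 1"
    by (rule Lim_transform_eventually[OF tendsto_const])
  ultimately have "(\<Sum>i=1..n. c i * v i) = 1" by (rule LIMSEQ_unique)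
  with zero show False by simp
qed

theorem theorem4:
  fixes n :: nat and A :: "nat \<Rightarrow> complex"
  assumes "1 \<le> n" and "A \<in> discriminant_set n"
  shows "(\<forall>l. order l (gen_poly n A) = 2 \<and> card {x. order x (gen_poly n A) = 1} = n - 2 \<longrightarrow>
            (l \<noteq> 0 \<longrightarrow>
               \<not> (A (n - 1) = 0 \<and> A n = 0) \<and>
               (\<forall>k\<in>{1..n}. locally_graph_at n k (discriminant_set n) A)) \<and>
            (l = 0 \<longrightarrow>
               locally_graph_at n n (discriminant_set n) A \<and>
               (\<forall>k\<in>{1..n - 1}. \<not> locally_graph_at n k (discriminant_set n) A)))
       \<and> ((\<exists>l. 3 \<le> order l (gen_poly n A)) \<longrightarrow>
            \<not> smooth_hypersurface_at n (discriminant_set n) A)"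
proof (intro conjI allI impI ballI)
  have A: "A \<in> cspace {1..n}" using assms(2) by (simp add: mem_discriminant_set)
  fix l assume l: "order l (gen_poly n A) = 2 \<and> card {x. order x (gen_poly n A) = 1} = n - 2"
  then have ord: "order l (gen_poly n A) = 2" by simp
  have uniq: "x = l" if "poly (gen_poly n A) x = 0" "poly (pderiv (gen_poly n A)) x = 0" for x
    using l that by (intro unique_multiple_root[of "gen_poly n A"]) (auto simp: order_ge_2_iff)
  have n: "2 \<le> n" using order_degree[OF gen_poly_nonzero, of l n A] ord by simp
  {
    assume "l \<noteq> 0"
    \<comment> \<open>By \<open>2 \<le> n\<close>, \<open>A n\<close> and \<open>A (n - 1)\<close>
      are the values of \<open>P\<close> and \<open>P'\<close> at 0; if both were zero, 0 would be a
      second multiple root.\<close>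
    show "\<not> (A (n - 1) = 0 \<and> A n = 0)"
    proof
      assume "A (n - 1) = 0 \<and> A n = 0"
      then have "coeff (gen_poly n A) 0 = 0" "coeff (pderiv (gen_poly n A)) 0 = 0"
        using n by (auto simp: coeff_gen_poly coeff_pderiv)
      then show False using uniq[of 0] \<open>l \<noteq> 0\<close> by (simp add: poly_0_coeff_0)
    qed
    fix k assume "k \<in> {1..n}"
    with \<open>l \<noteq> 0\<close> show "locally_graph_at n k (discriminant_set n) A"
      by (intro locally_graph_at_double_root[OF _ A ord _ uniq] disjI1)
  }
  assume "l = 0"
  show "locally_graph_at n n (discriminant_set n) A"
    using n by (intro locally_graph_at_double_root[OF _ A ord _ uniq]) simp_all
  fix k assume "k \<in> {1..n - 1}"
  then show "\<not> locally_graph_at n k (discriminant_set n) A"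
    using ord uniq unfolding \<open>l = 0\<close> by (intro not_locally_graph_at_zero[OF _ A])
next
  assume "\<exists>l. 3 \<le> order l (gen_poly n A)"
  then show "\<not> smooth_hypersurface_at n (discriminant_set n) A"
    using not_smooth_at_triple_root assms(2) by (auto simp: mem_discriminant_set)
qed

end
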